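(* Let $R$ be a commutative ring and let $X$ and $Y$ be two dihomeomorphic directed spaces, i.e. there is a homeomorphism $X\to Y$ which is a d-map and whose inverse is a d-map. Then for all $n\in\mathbb{N}$, $HA_n(X)$ and $HA_n(Y)$ are isomorphic (non-unital associative) $R$-algebras.
   Context: A directed space (d-space) is a topological space $X$ with a set $dX$ of continuous paths $[0,1]\to X$ (the d-paths) containing all constant paths, closed under precomposition with continuous non-decreasing maps $[0,1]\to[0,1]$, and closed under concatenation. A d-map $f:X\to Y$ is a continuous map with $f\circ p\in dY$ for every $p\in dX$. $\Delta_n=\{(t_0,\dots,t_n): t_j\ge 0,\ \sum_j t_j=1\}$ is the standard simplex, with face inclusions $\delta_k:\Delta_{n-1}\to\Delta_n$ (insert $0$ at position $k$) and degeneracies $\sigma_k:\Delta_n\to\Delta_{n-1}$, $0\le k<n$, $(t_0,\dots,t_n)\mapsto(t_0,\dots,t_k+t_{k+1},\dots,t_n)$. For $i\ge 1$, an $i$-path in $X$ is a continuous map $p:[0,1]\times\Delta_{i-1}\to X$ such that $p(\cdot,t)$ is a d-path for every $t\in\Delta_{i-1}$. For $a,b\in X$, an $i$-trace from $a$ to $b$ is a class of $i$-paths $p$ with $p(0,t)=a$ and $p(1,t)=b$ for all $t$, modulo reparametrization in the first coordinate (the equivalence relation generated by $p\sim p\circ(\varphi\times \mathrm{Id})$ with $\varphi:[0,1]\to[0,1]$ continuous, non-decreasing and surjective). The maps $d_j(p)=p\circ(\mathrm{Id}\times\delta_j)$ (from $(i+1)$-paths to $i$-paths, $0\le j\le i$)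 and $s_k(p)=p\circ(\mathrm{Id}\times\sigma_k)$ (from $i$-paths to $(i+1)$-paths, $0\le k\le i-1$) induce maps on traces preserving start and end points. $R_i[X]$, $i\ge1$, is the free $R$-module on all $i$-traces of $X$, with bilinear product determined on basis elements by $p\times q=p*q$ (concatenation in the first coordinate) if the end point of $p$ is the start point of $q$, and $p\times q=0$ otherwise. Extending $d_j,s_k$ linearly, $R[X]=(R_{i+1}[X])_{i\ge0}$ (with $R_{i+1}[X]$ in degree $i$) is a simplicial object in the category $Alg$ of non-unital associative $R$-algebras. For a simplicial algebra $S$ with faces $d^n_j:S_n\to S_{n-1}$, its Moore normalization $NS$ is $(NS)_n=\bigcap_{j=0}^{n-1}\ker d^n_j$ with differential $\partial^n=(-1)^n d^n_n:(NS)_n\to(NS)_{n-1}$ (zero for $n=0$). The image of $\partial^{n+1}$ is a two-sided ideal, and $H_n(NS)=\ker\partial^n/\mathrm{Im}\,\partial^{n+1}$ is an algebra. The directed homology algebras of $X$ are $HA_{i+1}(X)=H_i(NR[X])$ for $i\ge 0$, and $HA_0(X)=R_0[X]$, the $R$-algebra whose underlying module is free on pairs $(x,y)\in X^2$ such that there is a d-path from $x$ to $y$, with $(x,y)\times(z,t)=(x,t)$ if $y=z$ and $0$ otherwise. *)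

theory Defs
  imports "HOL-Homology.Simplices" "HOL-Algebra.QuotRing" "HOL-Algebra.Module"
begin

section \<open>Directed spaces\<close>

text \<open>
  Maps with domain \<open>[0,1]\<close> or \<open>[0,1] \<times> \<Delta>\<^sub>m\<close> are total HOL functions that are \<open>extensional\<close> on
  that domain, so that equality of functions is equality of maps. Composites are therefore
  cut off with \<open>restrict\<close>, as for \<^const>\<open>singular_face\<close>.
\<close>

record 'a dspace =
  dtop :: "'a topology"
  dpaths :: "(real \<Rightarrow> 'a) set"

definition nondec_map :: "(real \<Rightarrow> real) \<Rightarrow> bool" where
  "nondec_map \<phi> \<longleftrightarrow>
     continuous_on {0..1} \<phi> \<and> \<phi> ` {0..1} \<subseteq> {0..1} \<and> mono_on {0..1} \<phi>"

definition path_concat :: "(real \<Rightarrow> 'a) \<Rightarrow> (real \<Rightarrow> 'a) \<Rightarrow> real \<Rightarrow> 'a" where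
  "path_concat p q =
     restrict (\<lambda>s. if s \<le> 1/2 then p (2 * s) else q (2 * s - 1)) {0..1}"

definition directed_space :: "'a dspace \<Rightarrow> bool" where
  "directed_space X \<longleftrightarrow>
     (\<forall>p\<in>dpaths X. pathin (dtop X) p \<and> p \<in> extensional {0..1}) \<and>
     (\<forall>x\<in>topspace (dtop X). restrict (\<lambda>_. x) {0..1} \<in> dpaths X) \<and>
     (\<forall>p\<in>dpaths X. \<forall>\<phi>. nondec_map \<phi> \<longrightarrow> restrict (p \<circ> \<phi>) {0..1} \<in> dpaths X) \<and>
     (\<forall>p\<in>dpaths X. \<forall>q\<in>dpaths X. p 1 = q 0 \<longrightarrow> path_concat p q \<in> dpaths X)"

definition d_map :: "'a dspace \<Rightarrow> 'b dspace \<Rightarrow> ('a \<Rightarrow> 'b) \<Rightarrow> bool" where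
  "d_map X Y f \<longleftrightarrow>
     continuous_map (dtop X) (dtop Y) f \<and>
     (\<forall>p\<in>dpaths X. restrict (f \<circ> p) {0..1} \<in> dpaths Y)"

definition dihomeomorphic :: "'a dspace \<Rightarrow> 'b dspace \<Rightarrow> bool" where
  "dihomeomorphic X Y \<longleftrightarrow>
     (\<exists>f g. homeomorphic_maps (dtop X) (dtop Y) f g \<and> d_map X Y f \<and> d_map Y X g)"


section \<open>\<open>i\<close>-paths and \<open>i\<close>-traces\<close>

type_synonym 'a ipath = "real \<times> (nat \<Rightarrow> real) \<Rightarrow> 'a"

text \<open>
  As in \<^const>\<open>standard_simplex\<close>, a point of \<open>\<Delta>\<^sub>m\<close> is a sequence \<open>nat \<Rightarrow> real\<close> vanishing beyond
  index \<open>m\<close>; the face inclusion \<open>\<delta>\<^sub>k\<close> is \<^const>\<open>simplical_face\<close>. An \<open>i\<close>-path is only meant for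
  \<open>i \<ge> 1\<close>.
\<close>

abbreviation ipath_dom :: "nat \<Rightarrow> (real \<times> (nat \<Rightarrow> real)) set" where
  "ipath_dom i \<equiv> {0..1} \<times> standard_simplex (i - 1)"

definition ipaths :: "'a dspace \<Rightarrow> nat \<Rightarrow> 'a ipath set" where
  "ipaths X i =
     {p \<in> extensional (ipath_dom i).
        continuous_map
          (prod_topology (subtopology euclideanreal {0..1})
             (subtopology (powertop_real UNIV) (standard_simplex (i - 1))))
          (dtop X) p \<and>
        (\<forall>t\<in>standard_simplex (i - 1). restrict (\<lambda>s. p (s, t)) {0..1} \<in> dpaths X)}"

definition ipaths_between :: "'a dspace \<Rightarrow> nat \<Rightarrow> 'a \<Rightarrow> 'a \<Rightarrow> 'a ipath set" where
  "ipaths_between X i a b =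
     {p \<in> ipaths X i. \<forall>t\<in>standard_simplex (i - 1). p (0, t) = a \<and> p (1, t) = b}"

definition reparam_step :: "'a dspace \<Rightarrow> nat \<Rightarrow> 'a ipath \<Rightarrow> 'a ipath \<Rightarrow> bool" where
  "reparam_step X i p q \<longleftrightarrow>
     p \<in> ipaths X i \<and>
     (\<exists>\<phi>. nondec_map \<phi> \<and> \<phi> ` {0..1} = {0..1} \<and>
          q = restrict (\<lambda>(s, t). p (\<phi> s, t)) (ipath_dom i))"

definition trace_rel :: "'a dspace \<Rightarrow> nat \<Rightarrow> ('a ipath \<times> 'a ipath) set" where
  "trace_rel X i = {(p, q). equivclp (reparam_step X i) p q}"

definition traces_between :: "'a dspace \<Rightarrow> nat \<Rightarrow> 'a \<Rightarrow> 'a \<Rightarrow> 'a ipath set set" where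
  "traces_between X i a b = ipaths_between X i a b // trace_rel X i"

definition traces :: "'a dspace \<Rightarrow> nat \<Rightarrow> 'a ipath set set" where
  "traces X i = (\<Union>a\<in>topspace (dtop X). \<Union>b\<in>topspace (dtop X). traces_between X i a b)"

text \<open>
  Operations on traces are given by applying the operation to all representatives and taking
  the image under \<^const>\<open>trace_rel\<close>, i.e. the union of the classes of the results.
\<close>

definition ipath_concat :: "nat \<Rightarrow> 'a ipath \<Rightarrow> 'a ipath \<Rightarrow> 'a ipath" where
  "ipath_concat i p q =
     restrict (\<lambda>(s, t). if s \<le> 1/2 then p (2 * s, t) else q (2 * s - 1, t)) (ipath_dom i)"

definition trace_concat ::
  "'a dspace \<Rightarrow> nat \<Rightarrow> 'a ipath set \<Rightarrow> 'a ipath set \<Rightarrow> 'a ipath set" where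
  "trace_concat X i T U = trace_rel X i `` {ipath_concat i p q |p q. p \<in> T \<and> q \<in> U}"

definition simplical_degen :: "nat \<Rightarrow> (nat \<Rightarrow> real) \<Rightarrow> nat \<Rightarrow> real" where
  "simplical_degen k x =
     (\<lambda>j. if j < k then x j else if j = k then x k + x (Suc k) else x (Suc j))"

text \<open>\<open>ipath_face i j\<close> goes from \<open>(i+1)\<close>-paths to \<open>i\<close>-paths, \<open>ipath_degen i k\<close> from \<open>i\<close>-paths to
  \<open>(i+1)\<close>-paths.\<close>

definition ipath_face :: "nat \<Rightarrow> nat \<Rightarrow> 'a ipath \<Rightarrow> 'a ipath" where
  "ipath_face i j p = restrict (\<lambda>(s, t). p (s, simplical_face j t)) (ipath_dom i)"

definition ipath_degen :: "nat \<Rightarrow> nat \<Rightarrow> 'a ipath \<Rightarrow> 'a ipath" where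
  "ipath_degen i k p = restrict (\<lambda>(s, t). p (s, simplical_degen k t)) (ipath_dom (Suc i))"

definition trace_face :: "'a dspace \<Rightarrow> nat \<Rightarrow> nat \<Rightarrow> 'a ipath set \<Rightarrow> 'a ipath set" where
  "trace_face X i j T = trace_rel X i `` (ipath_face i j ` T)"

definition trace_degen :: "'a dspace \<Rightarrow> nat \<Rightarrow> nat \<Rightarrow> 'a ipath set \<Rightarrow> 'a ipath set" where
  "trace_degen X i k T = trace_rel X (Suc i) `` (ipath_degen i k ` T)"


section \<open>Non-unital associative algebras\<close>

text \<open>
  Algebras are carried by the record type \<^typ>\<open>('r, 'm) module\<close>, whose field \<open>one\<close> plays no role:
  neither \<^locale>\<open>module\<close> nor anything below refers to it, and it is left undefined.
\<close>

locale nonunital_algebra = module +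
  assumes mult_closed:
      "\<lbrakk>x \<in> carrier M; y \<in> carrier M\<rbrakk> \<Longrightarrow> x \<otimes>\<^bsub>M\<^esub> y \<in> carrier M"
    and mult_assoc:
      "\<lbrakk>x \<in> carrier M; y \<in> carrier M; z \<in> carrier M\<rbrakk>
        \<Longrightarrow> (x \<otimes>\<^bsub>M\<^esub> y) \<otimes>\<^bsub>M\<^esub> z = x \<otimes>\<^bsub>M\<^esub> (y \<otimes>\<^bsub>M\<^esub> z)"
    and mult_l_distr:
      "\<lbrakk>x \<in> carrier M; y \<in> carrier M; z \<in> carrier M\<rbrakk>
        \<Longrightarrow> (x \<oplus>\<^bsub>M\<^esub> y) \<otimes>\<^bsub>M\<^esub> z = x \<otimes>\<^bsub>M\<^esub> z \<oplus>\<^bsub>M\<^esub> y \<otimes>\<^bsub>M\<^esub> z"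
    and mult_r_distr:
      "\<lbrakk>x \<in> carrier M; y \<in> carrier M; z \<in> carrier M\<rbrakk>
        \<Longrightarrow> z \<otimes>\<^bsub>M\<^esub> (x \<oplus>\<^bsub>M\<^esub> y) = z \<otimes>\<^bsub>M\<^esub> x \<oplus>\<^bsub>M\<^esub> z \<otimes>\<^bsub>M\<^esub> y"
    and smult_mult_l:
      "\<lbrakk>a \<in> carrier R; x \<in> carrier M; y \<in> carrier M\<rbrakk>
        \<Longrightarrow> (a \<odot>\<^bsub>M\<^esub> x) \<otimes>\<^bsub>M\<^esub> y = a \<odot>\<^bsub>M\<^esub> (x \<otimes>\<^bsub>M\<^esub> y)"
    and smult_mult_r:
      "\<lbrakk>a \<in> carrier R; x \<in> carrier M; y \<in> carrier M\<rbrakk>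
        \<Longrightarrow> x \<otimes>\<^bsub>M\<^esub> (a \<odot>\<^bsub>M\<^esub> y) = a \<odot>\<^bsub>M\<^esub> (x \<otimes>\<^bsub>M\<^esub> y)"

definition algebra_hom ::
  "('r, 'x) ring_scheme \<Rightarrow> ('r, 'm, 'y) module_scheme \<Rightarrow> ('r, 'n, 'z) module_scheme \<Rightarrow> ('m \<Rightarrow> 'n) set"
  where
  "algebra_hom R A B =
     {h \<in> carrier A \<rightarrow> carrier B.
        (\<forall>x\<in>carrier A. \<forall>y\<in>carrier A. h (x \<oplus>\<^bsub>A\<^esub> y) = h x \<oplus>\<^bsub>B\<^esub> h y) \<and>
        (\<forall>x\<in>carrier A. \<forall>y\<in>carrier A. h (x \<otimes>\<^bsub>A\<^esub> y) = h x \<otimes>\<^bsub>B\<^esub> h y) \<and>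
        (\<forall>a\<in>carrier R. \<forall>x\<in>carrier A. h (a \<odot>\<^bsub>A\<^esub> x) = a \<odot>\<^bsub>B\<^esub> h x)}"

definition isomorphic_algebras ::
  "('r, 'x) ring_scheme \<Rightarrow> ('r, 'm, 'y) module_scheme \<Rightarrow> ('r, 'n, 'z) module_scheme \<Rightarrow> bool" where
  "isomorphic_algebras R A B \<longleftrightarrow>
     nonunital_algebra R A \<and> nonunital_algebra R B \<and>
     (\<exists>h\<in>algebra_hom R A B. bij_betw h (carrier A) (carrier B))"

definition quotient_algebra ::
  "('r, 'm, 'x) module_scheme \<Rightarrow> 'm set \<Rightarrow> ('r, 'm set) module" where
  "quotient_algebra A I =
     \<lparr>carrier = a_rcosets\<^bsub>A\<^esub> I, mult = rcoset_mult A I, one = undefined, zero = I,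
      add = set_add A, smult = (\<lambda>a C. \<Union>x\<in>C. I +>\<^bsub>A\<^esub> (a \<odot>\<^bsub>A\<^esub> x))\<rparr>"

text \<open>
  The free module on \<open>B\<close>: finitely supported coefficient functions, zero outside \<open>B\<close>. Its product is
  the bilinear extension of a partial operation \<open>c\<close> on \<open>B\<close>, products of basis elements being zero
  where \<open>c\<close> is undefined.
\<close>

definition free_algebra ::
  "('r, 'x) ring_scheme \<Rightarrow> 'b set \<Rightarrow> ('b \<Rightarrow> 'b \<Rightarrow> 'b option) \<Rightarrow> ('r, 'b \<Rightarrow> 'r) module" where
  "free_algebra R B c =
     \<lparr>carrier = {f. (\<forall>b. f b \<in> carrier R) \<and> (\<forall>b. b \<notin> B \<longrightarrow> f b = \<zero>\<^bsub>R\<^esub>) \<and>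
                    finite {b. f b \<noteq> \<zero>\<^bsub>R\<^esub>}},
      mult = (\<lambda>f g d. finsum R (\<lambda>(a, b). f a \<otimes>\<^bsub>R\<^esub> g b)
                         {(a, b). f a \<noteq> \<zero>\<^bsub>R\<^esub> \<and> g b \<noteq> \<zero>\<^bsub>R\<^esub> \<and> c a b = Some d}),
      one = undefined,
      zero = (\<lambda>_. \<zero>\<^bsub>R\<^esub>),
      add = (\<lambda>f g b. f b \<oplus>\<^bsub>R\<^esub> g b),
      smult = (\<lambda>a f b. a \<otimes>\<^bsub>R\<^esub> f b)\<rparr>"

definition linear_extension ::
  "('r, 'x) ring_scheme \<Rightarrow> ('b \<Rightarrow> 'd) \<Rightarrow> ('b \<Rightarrow> 'r) \<Rightarrow> 'd \<Rightarrow> 'r" where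
  "linear_extension R h f = (\<lambda>d. \<Oplus>\<^bsub>R\<^esub>b\<in>{b. f b \<noteq> \<zero>\<^bsub>R\<^esub> \<and> h b = d}. f b)"


section \<open>Simplicial algebras and Moore normalization\<close>

text \<open>\<open>face S n j\<close> goes from degree \<open>n\<close> to degree \<open>n - 1\<close> and \<open>degen S n k\<close> from degree \<open>n\<close> to degree
  \<open>n + 1\<close>. The record only carries the data of a simplicial algebra, not its laws.\<close>

record ('r, 'm) simplicial_data =
  level :: "nat \<Rightarrow> ('r, 'm) module"
  face :: "nat \<Rightarrow> nat \<Rightarrow> 'm \<Rightarrow> 'm"
  degen :: "nat \<Rightarrow> nat \<Rightarrow> 'm \<Rightarrow> 'm"

definition moore :: "('r, 'm) simplicial_data \<Rightarrow> nat \<Rightarrow> ('r, 'm) module" where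
  "moore S n = (level S n)
     \<lparr>carrier := {x \<in> carrier (level S n). \<forall>j<n. face S n j x = \<zero>\<^bsub>level S (n - 1)\<^esub>}\<rparr>"

text \<open>In degree 0 the differential is zero (with the junk codomain \<open>level S 0\<close>).\<close>

definition moore_diff ::
  "('r, 'x) ring_scheme \<Rightarrow> ('r, 'm) simplicial_data \<Rightarrow> nat \<Rightarrow> 'm \<Rightarrow> 'm" where
  "moore_diff R S n x =
     (if n = 0 then \<zero>\<^bsub>level S 0\<^esub>
      else ((\<ominus>\<^bsub>R\<^esub> \<one>\<^bsub>R\<^esub>) [^]\<^bsub>R\<^esub> n) \<odot>\<^bsub>level S (n - 1)\<^esub> face S n n x)"

definition moore_cycles ::
  "('r, 'x) ring_scheme \<Rightarrow> ('r, 'm) simplicial_data \<Rightarrow> nat \<Rightarrow> ('r, 'm) module" where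
  "moore_cycles R S n = (moore S n)
     \<lparr>carrier := {x \<in> carrier (moore S n). moore_diff R S n x = \<zero>\<^bsub>level S (n - 1)\<^esub>}\<rparr>"

definition moore_boundaries ::
  "('r, 'x) ring_scheme \<Rightarrow> ('r, 'm) simplicial_data \<Rightarrow> nat \<Rightarrow> 'm set" where
  "moore_boundaries R S n = moore_diff R S (Suc n) ` carrier (moore S (Suc n))"

definition moore_homology ::
  "('r, 'x) ring_scheme \<Rightarrow> ('r, 'm) simplicial_data \<Rightarrow> nat \<Rightarrow> ('r, 'm set) module" where
  "moore_homology R S n = quotient_algebra (moore_cycles R S n) (moore_boundaries R S n)"


section \<open>Directed homology algebras\<close>

definition trace_mult ::
  "'a dspace \<Rightarrow> nat \<Rightarrow> 'a ipath set \<Rightarrow> 'a ipath set \<Rightarrow> 'a ipath set option" where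
  "trace_mult X i T U =
     (if \<exists>a b c. T \<in> traces_between X i a b \<and> U \<in> traces_between X i b c
      then Some (trace_concat X i T U) else None)"

definition trace_algebra ::
  "('r, 'x) ring_scheme \<Rightarrow> 'a dspace \<Rightarrow> nat \<Rightarrow> ('r, 'a ipath set \<Rightarrow> 'r) module" where
  "trace_algebra R X i = free_algebra R (traces X i) (trace_mult X i)"

definition simplicial_trace_algebra ::
  "('r, 'x) ring_scheme \<Rightarrow> 'a dspace \<Rightarrow> ('r, 'a ipath set \<Rightarrow> 'r) simplicial_data" where
  "simplicial_trace_algebra R X =
     \<lparr>level = (\<lambda>n. trace_algebra R X (n + 1)),
      face = (\<lambda>n j. linear_extension R (trace_face X n j)),
      degen = (\<lambda>n k. linear_extension R (trace_degen X (n + 1) k))\<rparr>"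

definition reachable_pairs :: "'a dspace \<Rightarrow> ('a \<times> 'a) set" where
  "reachable_pairs X = {(x, y). \<exists>p\<in>dpaths X. p 0 = x \<and> p 1 = y}"

definition pair_mult :: "'a \<times> 'a \<Rightarrow> 'a \<times> 'a \<Rightarrow> ('a \<times> 'a) option" where
  "pair_mult u v = (if snd u = fst v then Some (fst u, snd v) else None)"

text \<open>
  \<open>HA_zero R X\<close> is \<open>HA\<^sub>0(X)\<close> and \<open>HA_Suc R X i\<close> is \<open>HA\<^sub>i\<^sub>+\<^sub>1(X)\<close>; they have different types of elements
  and hence are separate constants.
\<close>

definition HA_zero :: "('r, 'x) ring_scheme \<Rightarrow> 'a dspace \<Rightarrow> ('r, 'a \<times> 'a \<Rightarrow> 'r) module" where
  "HA_zero R X = free_algebra R (reachable_pairs X) pair_mult"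

definition HA_Suc ::
  "('r, 'x) ring_scheme \<Rightarrow> 'a dspace \<Rightarrow> nat \<Rightarrow> ('r, ('a ipath set \<Rightarrow> 'r) set) module" where
  "HA_Suc R X i = moore_homology R (simplicial_trace_algebra R X) i"

end

theory Submission
  imports Defs
begin

text \<open>
  A d-map \<open>f\<close> and a map \<open>\<theta>\<close> of simplices act together on \<open>i\<close>-paths by
  \<open>p \<mapsto> f \<circ> p \<circ> (Id \<times> \<theta>)\<close>. Faces and degeneracies are the case \<open>f = id\<close>, and the map induced by
  a dihomeomorphism is the case \<open>\<theta> = id\<close>. This action commutes with reparametrization and with
  concatenation, and it is functorial. The simplicial identities, the naturality of the induced map
  and its invertibility are therefore all instances of functoriality, which survives the passage to
  free algebras, Moore cycles and quotients. Boundaries form an ideal because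
  \<open>y * \<partial> x = \<partial> (s\<^sub>n y * x)\<close> for every \<open>y\<close> in degree \<open>n\<close>.
\<close>

section \<open>Free algebras\<close>

text \<open>Undefined products of basis elements count as zero, so in general a map of bases must
  preserve undefinedness as well as products in order to extend to an algebra homomorphism. A d-map
  that identifies two points can make non-composable traces composable, so an arbitrary d-map need
  not act on these algebras; the proof relies on the injectivity that a dihomeomorphism provides.
  This is why a basis is treated as a semigroup with an \<open>option\<close>-valued operation:
  associativity and preservation of products become equations in \<open>option\<close>. The other
  obstacle is that traces are classes of a relation generated by steps that are not symmetric, while
  concatenation makes sense only for matching end points. Well-definedness is therefore checked on
  one reparametrization at a time and spread to the generated equivalence. Concatenation itself is
  associative only up to such a reparametrization.\<close>

locale partial_semigroup =
  fixes B :: "'b set" and c :: "'b \<Rightarrow> 'b \<Rightarrow> 'b option"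
  assumes closed: "\<lbrakk>a \<in> B; b \<in> B; c a b = Some d\<rbrakk> \<Longrightarrow> d \<in> B"
    and assoc: "\<lbrakk>a \<in> B; b \<in> B; d \<in> B\<rbrakk> \<Longrightarrow>
      Option.bind (c a b) (\<lambda>e. c e d) = Option.bind (c b d) (c a)"

text \<open>Equality in \<open>option\<close> works in both directions: \<open>e (h a) (h b)\<close>
  is \<open>None\<close> exactly when \<open>c a b\<close> is. If it were defined for an undefined
  \<open>c a b\<close>, the extension of \<open>h\<close> could send a zero product to a nonzero
  one.\<close>

definition partial_semigroup_hom ::
  "'b set \<Rightarrow> ('b \<Rightarrow> 'b \<Rightarrow> 'b option) \<Rightarrow> 'd set \<Rightarrow> ('d \<Rightarrow> 'd \<Rightarrow> 'd option) \<Rightarrow> ('b \<Rightarrow> 'd) set"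
  where
  "partial_semigroup_hom B c D e =
     {h \<in> B \<rightarrow> D. \<forall>a\<in>B. \<forall>b\<in>B. e (h a) (h b) = map_option h (c a b)}"

text \<open>Carrying the coefficient along makes these elements generate the free module additively,
  so that inductions deal with sums alone.\<close>

definition single :: "('r, 'x) ring_scheme \<Rightarrow> 'r \<Rightarrow> 'b \<Rightarrow> 'b \<Rightarrow> 'r" where
  "single R r b = (\<lambda>x. if x = b then r else \<zero>\<^bsub>R\<^esub>)"

section \<open>Module structure of the free algebra and its additive generators\<close>

context cring
begin

lemma free_algebra_carrierD:
  assumes "f \<in> carrier (free_algebra R B c)"
  shows "f b \<in> carrier R" "b \<notin> B \<Longrightarrow> f b = \<zero>" "finite {b. f b \<noteq> \<zero>}"
  using assms by (auto simp: free_algebra_def)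

lemma abelian_group_free_algebra: "abelian_group (free_algebra R B c)"
proof (rule abelian_groupI, goal_cases)
  case (1 x y)
  moreover have "{b. x b \<oplus> y b \<noteq> \<zero>} \<subseteq> {b. x b \<noteq> \<zero>} \<union> {b. y b \<noteq> \<zero>}"
    by (auto simp: free_algebra_carrierD[OF 1(1)])
  moreover have "finite ({b. x b \<noteq> \<zero>} \<union> {b. y b \<noteq> \<zero>})"
    using 1 by (simp add: free_algebra_carrierD(3))
  ultimately have "finite {b. x b \<oplus> y b \<noteq> \<zero>}"
    using finite_subset by blast
  with 1 show ?case
    by (simp add: free_algebra_def)
next
  case (6 x)
  then show ?case
    by (intro bexI[of _ "\<lambda>b. \<ominus> x b"]) (auto simp: free_algebra_def l_neg cong: conj_cong)
qed (auto simp: free_algebra_def a_ac)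

lemma module_free_algebra: "module R (free_algebra R B c)"
proof (rule moduleI, goal_cases)
  case (3 a x)
  then have "{b. a \<otimes> x b \<noteq> \<zero>} \<subseteq> {b. x b \<noteq> \<zero>}"
    by auto
  then have "finite {b. a \<otimes> x b \<noteq> \<zero>}"
    using 3 free_algebra_carrierD(3) finite_subset by blast
  with 3 show ?case
    by (simp add: free_algebra_def)
qed (auto simp: free_algebra_def l_distr r_distr m_assoc abelian_group_free_algebra[unfolded free_algebra_def] is_cring)

lemma single_closed:
  assumes "r \<in> carrier R" "b \<in> B"
  shows "single R r b \<in> carrier (free_algebra R B c)"
proof -
  have "{x. (if x = b then r else \<zero>) \<noteq> \<zero>} \<subseteq> {b}"
    by auto
  then have "finite {x. (if x = b then r else \<zero>) \<noteq> \<zero>}"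
    using finite_subset by blast
  with assms show ?thesis
    by (auto simp: single_def free_algebra_def)
qed

text \<open>The support is finite, and erasing the value at one point \<open>a\<close> of it splits
  off \<open>single R (f a) a\<close>. The induction runs over finite sets containing the support,
  so a point outside the support may be dropped as well.\<close>

lemma free_algebra_induct [consumes 1, case_names zero add]:
  assumes f: "f \<in> carrier (free_algebra R B c)"
    and zero: "P \<zero>\<^bsub>free_algebra R B c\<^esub>"
    and add: "\<And>r b f. \<lbrakk>r \<in> carrier R; b \<in> B; f \<in> carrier (free_algebra R B c); P f\<rbrakk> \<Longrightarrow>
      P (single R r b \<oplus>\<^bsub>free_algebra R B c\<^esub> f)"
  shows "P f"
proof -
  let ?F = "free_algebra R B c"
  have "\<forall>f\<in>carrier ?F. {b. f b \<noteq> \<zero>} \<subseteq> A \<longrightarrow> P f" if "finite A" for A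
    using that
  proof (induction A)
    case empty
    have "f = \<zero>\<^bsub>?F\<^esub>" if "{b. f b \<noteq> \<zero>} \<subseteq> {}" for f
      using that by (auto simp: free_algebra_def)
    with zero show ?case
      by blast
  next
    case (insert a A)
    show ?case
    proof (intro ballI impI)
      fix f assume f: "f \<in> carrier ?F" and supp: "{b. f b \<noteq> \<zero>} \<subseteq> insert a A"
      show "P f"
      proof (cases "f a = \<zero>")
        case True
        with supp insert.IH f show ?thesis
          by blast
      next
        case False
        then have a: "a \<in> B"
          using free_algebra_carrierD(2)[OF f] by blast
        have "finite {b. (f(a := \<zero>)) b \<noteq> \<zero>}"
          by (rule finite_subset[OF _ free_algebra_carrierD(3)[OF f]]) auto
        with f have *: "f(a := \<zero>) \<in> carrier ?F"
          by (simp add: free_algebra_def)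
        moreover have "{b. (f(a := \<zero>)) b \<noteq> \<zero>} \<subseteq> A"
          using supp by auto
        ultimately have "P (f(a := \<zero>))"
          using insert.IH by blast
        moreover have "f = single R (f a) a \<oplus>\<^bsub>?F\<^esub> f(a := \<zero>)"
          using free_algebra_carrierD(1)[OF f] by (auto simp: free_algebra_def single_def)
        ultimately show ?thesis
          using add[OF free_algebra_carrierD(1)[OF f] a *] by metis
      qed
    qed
  qed
  with f show ?thesis
    using free_algebra_carrierD(3)[OF f] by blast
qed

text \<open>Additive maps that agree on additive generators agree. As only additivity enters, the
  rule applies to linear extensions and to multiplication by a fixed element on either side, and
  bilinear identities are reduced one variable at a time.\<close>

lemma free_algebra_ext:
  assumes M: "abelian_group M"
    and h: "h \<in> carrier (free_algebra R B c) \<rightarrow> carrier M"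
    and h_add: "\<And>x y. \<lbrakk>x \<in> carrier (free_algebra R B c); y \<in> carrier (free_algebra R B c)\<rbrakk> \<Longrightarrow>
      h (x \<oplus>\<^bsub>free_algebra R B c\<^esub> y) = h x \<oplus>\<^bsub>M\<^esub> h y"
    and k: "k \<in> carrier (free_algebra R B c) \<rightarrow> carrier M"
    and k_add: "\<And>x y. \<lbrakk>x \<in> carrier (free_algebra R B c); y \<in> carrier (free_algebra R B c)\<rbrakk> \<Longrightarrow>
      k (x \<oplus>\<^bsub>free_algebra R B c\<^esub> y) = k x \<oplus>\<^bsub>M\<^esub> k y"
    and eq: "\<And>r b. \<lbrakk>r \<in> carrier R; b \<in> B\<rbrakk> \<Longrightarrow> h (single R r b) = k (single R r b)"
    and f: "f \<in> carrier (free_algebra R B c)"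
  shows "h f = k f"
  using f
proof (induction rule: free_algebra_induct)
  case zero
  interpret M: abelian_group M by fact
  interpret F: abelian_group "free_algebra R B c" by (rule abelian_group_free_algebra)
  \<comment> \<open>An additive map satisfies u 0 + u 0 = u 0, and cancellation in the target gives
    u 0 = 0.\<close>
  have "u \<zero>\<^bsub>free_algebra R B c\<^esub> = \<zero>\<^bsub>M\<^esub>"
    if "u \<in> carrier (free_algebra R B c) \<rightarrow> carrier M"
      and "\<And>x y. \<lbrakk>x \<in> carrier (free_algebra R B c); y \<in> carrier (free_algebra R B c)\<rbrakk> \<Longrightarrow>
        u (x \<oplus>\<^bsub>free_algebra R B c\<^esub> y) = u x \<oplus>\<^bsub>M\<^esub> u y" for u
    using that(1) that(2)[of "\<zero>\<^bsub>free_algebra R B c\<^esub>" "\<zero>\<^bsub>free_algebra R B c\<^esub>"]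
    by (metis F.add.l_cancel_one F.zero_closed M.add.r_cancel_one Pi_mem F.l_zero)
  then show ?case
    using h h_add k k_add by metis
next
  case (add r b f)
  then show ?case
    using h_add k_add eq by (simp add: single_closed)
qed

text \<open>The defining sum ranges over a set that depends on \<open>f\<close>, \<open>g\<close>
  and \<open>d\<close>. Padding with zeros moves it to a rectangle chosen in advance, so that sums
  for different factors can be combined term by term.\<close>

lemma free_algebra_mult_eq:
  assumes f: "f \<in> carrier (free_algebra R B c)" and g: "g \<in> carrier (free_algebra R B c)"
    and A: "finite A" "{a. f a \<noteq> \<zero>} \<subseteq> A" and C: "finite C" "{b. g b \<noteq> \<zero>} \<subseteq> C"
  shows "(f \<otimes>\<^bsub>free_algebra R B c\<^esub> g) d =
    finsum R (\<lambda>(a, b). if c a b = Some d then f a \<otimes> g b else \<zero>) (A \<times> C)"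
proof -
  note [simp] = free_algebra_carrierD(1)[OF f] free_algebra_carrierD(1)[OF g]
  show ?thesis
    unfolding free_algebra_def using A C
    by (auto intro!: add.finprod_mono_neutral_cong_left split: if_splits)
qed

lemma linear_extension_eq:
  assumes f: "f \<in> carrier (free_algebra R B c)" and A: "finite A" "{a. f a \<noteq> \<zero>} \<subseteq> A"
  shows "linear_extension R h f d = (\<Oplus>b\<in>A. if h b = d then f b else \<zero>)"
proof -
  note [simp] = free_algebra_carrierD(1)[OF f]
  show ?thesis
    unfolding linear_extension_def using A
    by (auto intro!: add.finprod_mono_neutral_cong_left split: if_splits)
qed

section \<open>Products and linear extensions on generators\<close>

lemma free_algebra_mult_single:
  assumes "r \<in> carrier R" "s \<in> carrier R" "a \<in> B" "b \<in> B"
  shows "single R r a \<otimes>\<^bsub>free_algebra R B c\<^esub> single R s b =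
    (case c a b of None \<Rightarrow> \<zero>\<^bsub>free_algebra R B c\<^esub> | Some d \<Rightarrow> single R (r \<otimes> s) d)"
proof
  fix d
  have "(single R r a \<otimes>\<^bsub>free_algebra R B c\<^esub> single R s b) d =
      finsum R (\<lambda>(a', b'). if c a' b' = Some d then single R r a a' \<otimes> single R s b b' else \<zero>) ({a} \<times> {b})"
    using assms by (intro free_algebra_mult_eq single_closed) (auto simp: single_def)
  also have "\<dots> = (if c a b = Some d then r \<otimes> s else \<zero>)"
    using assms by (simp add: single_def)
  finally show "(single R r a \<otimes>\<^bsub>free_algebra R B c\<^esub> single R s b) d =
      (case c a b of None \<Rightarrow> \<zero>\<^bsub>free_algebra R B c\<^esub> | Some d \<Rightarrow> single R (r \<otimes> s) d) d"
    by (auto simp: single_def free_algebra_def split: option.split)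
qed

lemma linear_extension_single:
  assumes "r \<in> carrier R" "b \<in> B"
  shows "linear_extension R h (single R r b) = single R r (h b)"
proof
  fix d
  have "linear_extension R h (single R r b) d =
      (\<Oplus>x\<in>{b}. if h x = d then single R r b x else \<zero>)"
    using single_closed[OF assms, of "\<lambda>_ _. None"] by (rule linear_extension_eq) (auto simp: single_def)
  then show "linear_extension R h (single R r b) d = single R r (h b) d"
    using assms by (simp add: single_def)
qed

lemma free_algebra_add_apply: "(f \<oplus>\<^bsub>free_algebra R B c\<^esub> g) b = f b \<oplus> g b"
  and free_algebra_smult_apply: "(r \<odot>\<^bsub>free_algebra R B c\<^esub> f) b = r \<otimes> f b"
  by (simp_all add: free_algebra_def)

text \<open>Addition is pointwise, so every choice of \<open>D\<close> and \<open>e\<close> gives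
  the same right-hand side. They are left free to match the target at hand, and later uses
  instantiate them explicitly.\<close>

lemma linear_extension_add:
  assumes f: "f \<in> carrier (free_algebra R B c)" and g: "g \<in> carrier (free_algebra R B c)"
  shows "linear_extension R h (f \<oplus>\<^bsub>free_algebra R B c\<^esub> g) =
    linear_extension R h f \<oplus>\<^bsub>free_algebra R D e\<^esub> linear_extension R h g"
proof
  fix d
  let ?A = "{a. f a \<noteq> \<zero>} \<union> {a. g a \<noteq> \<zero>}"
  interpret F: abelian_group "free_algebra R B c" by (rule abelian_group_free_algebra)
  note [simp] = free_algebra_carrierD(1)[OF f] free_algebra_carrierD(1)[OF g]
  have A: "finite ?A"
    using f g by (auto simp: free_algebra_carrierD(3))
  have "linear_extension R h (f \<oplus>\<^bsub>free_algebra R B c\<^esub> g) d =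
      (\<Oplus>b\<in>?A. if h b = d then (f \<oplus>\<^bsub>free_algebra R B c\<^esub> g) b else \<zero>)"
    using f g A by (intro linear_extension_eq F.a_closed) (auto simp: free_algebra_add_apply)
  also have "\<dots> = (\<Oplus>b\<in>?A. (if h b = d then f b else \<zero>) \<oplus> (if h b = d then g b else \<zero>))"
    by (intro finsum_cong') (auto simp: free_algebra_add_apply)
  also have "\<dots> = (\<Oplus>b\<in>?A. if h b = d then f b else \<zero>) \<oplus> (\<Oplus>b\<in>?A. if h b = d then g b else \<zero>)"
    by (intro finsum_addf) auto
  also have "(\<Oplus>b\<in>?A. if h b = d then f b else \<zero>) = linear_extension R h f d"
    using f A by (intro linear_extension_eq[symmetric]) auto
  also have "(\<Oplus>b\<in>?A. if h b = d then g b else \<zero>) = linear_extension R h g d"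
    using g A by (intro linear_extension_eq[symmetric]) auto
  finally show "linear_extension R h (f \<oplus>\<^bsub>free_algebra R B c\<^esub> g) d =
      (linear_extension R h f \<oplus>\<^bsub>free_algebra R D e\<^esub> linear_extension R h g) d"
    by (subst free_algebra_add_apply)
qed

lemma linear_extension_smult:
  assumes r: "r \<in> carrier R" and f: "f \<in> carrier (free_algebra R B c)"
  shows "linear_extension R h (r \<odot>\<^bsub>free_algebra R B c\<^esub> f) =
    r \<odot>\<^bsub>free_algebra R D e\<^esub> linear_extension R h f"
proof
  fix d
  let ?A = "{a. f a \<noteq> \<zero>}"
  interpret F: module R "free_algebra R B c" by (rule module_free_algebra)
  note [simp] = free_algebra_carrierD(1)[OF f] free_algebra_carrierD(3)[OF f] r
  have "linear_extension R h (r \<odot>\<^bsub>free_algebra R B c\<^esub> f) d =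
      (\<Oplus>b\<in>?A. if h b = d then (r \<odot>\<^bsub>free_algebra R B c\<^esub> f) b else \<zero>)"
    using r f by (intro linear_extension_eq F.smult_closed) (auto simp: free_algebra_smult_apply)
  also have "\<dots> = (\<Oplus>b\<in>?A. r \<otimes> (if h b = d then f b else \<zero>))"
    by (intro finsum_cong') (auto simp: free_algebra_smult_apply)
  also have "\<dots> = r \<otimes> (\<Oplus>b\<in>?A. if h b = d then f b else \<zero>)"
    by (intro finsum_rdistr[symmetric]) auto
  also have "(\<Oplus>b\<in>?A. if h b = d then f b else \<zero>) = linear_extension R h f d"
    using f by (intro linear_extension_eq[symmetric]) auto
  finally show "linear_extension R h (r \<odot>\<^bsub>free_algebra R B c\<^esub> f) d =
      (r \<odot>\<^bsub>free_algebra R D e\<^esub> linear_extension R h f) d"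
    by (subst free_algebra_smult_apply)
qed

lemma linear_extension_closed:
  assumes h: "h \<in> B \<rightarrow> D" and f: "f \<in> carrier (free_algebra R B c)"
  shows "linear_extension R h f \<in> carrier (free_algebra R D e)"
  using f
proof (induction rule: free_algebra_induct)
  case zero
  have "linear_extension R h \<zero>\<^bsub>free_algebra R B c\<^esub> = \<zero>\<^bsub>free_algebra R D e\<^esub>"
    by (auto simp: linear_extension_def free_algebra_def)
  then show ?case
    using abelian_group_free_algebra by (metis abelian_group.axioms(1) abelian_monoid.zero_closed)
next
  case (add r b f)
  interpret E: abelian_group "free_algebra R D e" by (rule abelian_group_free_algebra)
  have "single R r (h b) \<in> carrier (free_algebra R D e)"
    using add.hyps h by (auto intro: single_closed)
  with add show ?case
    by (simp add: linear_extension_add[where D = D and e = e] linear_extension_single[where B = B] single_closed)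
qed

text \<open>Both sides are additive in \<open>f\<close> and agree on generators. Since
  \<open>k\<close> may take any values, the common target is the free module on the whole type; the
  nowhere defined operation \<open>?N\<close> is a filler, as products do not occur here.\<close>

lemma linear_extension_compose:
  assumes h: "h \<in> B \<rightarrow> D" and f: "f \<in> carrier (free_algebra R B c)"
  shows "linear_extension R k (linear_extension R h f) = linear_extension R (k \<circ> h) f"
proof (rule free_algebra_ext[OF _ _ _ _ _ _ f, where M = "free_algebra R UNIV (\<lambda>_ _. None)"])
  let ?N = "\<lambda>_ _. None"
  show "abelian_group (free_algebra R UNIV ?N)"
    by (rule abelian_group_free_algebra)
  show "(\<lambda>f. linear_extension R k (linear_extension R h f))
      \<in> carrier (free_algebra R B c) \<rightarrow> carrier (free_algebra R UNIV ?N)"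
    by (intro funcsetI linear_extension_closed[where B = UNIV and c = ?N] linear_extension_closed[where B = B and c = c]) auto
  show "linear_extension R (k \<circ> h)
      \<in> carrier (free_algebra R B c) \<rightarrow> carrier (free_algebra R UNIV ?N)"
    by (intro funcsetI linear_extension_closed[where B = B and c = c]) auto
  show "linear_extension R k (linear_extension R h (x \<oplus>\<^bsub>free_algebra R B c\<^esub> y)) =
      linear_extension R k (linear_extension R h x) \<oplus>\<^bsub>free_algebra R UNIV ?N\<^esub>
      linear_extension R k (linear_extension R h y)"
    if "x \<in> carrier (free_algebra R B c)" "y \<in> carrier (free_algebra R B c)" for x y
    using that linear_extension_closed[OF h, where e = ?N]
    by (simp add: linear_extension_add[where D = D and e = ?N] linear_extension_add[where D = UNIV and e = ?N])
qed (use h in \<open>auto simp: linear_extension_add[where D = UNIV and e = "\<lambda>_ _. None"]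
       linear_extension_single[where B = UNIV]\<close>)

lemma linear_extension_cong:
  assumes "\<And>b. b \<in> B \<Longrightarrow> h b = k b" and f: "f \<in> carrier (free_algebra R B c)"
  shows "linear_extension R h f = linear_extension R k f"
proof -
  have "{b. f b \<noteq> \<zero> \<and> h b = d} = {b. f b \<noteq> \<zero> \<and> k b = d}" for d
    using assms(1) free_algebra_carrierD(2)[OF f] by metis
  then show ?thesis
    by (simp add: linear_extension_def)
qed

lemma linear_extension_id:
  assumes f: "f \<in> carrier (free_algebra R B c)"
  shows "linear_extension R (\<lambda>x. x) f = f"
proof
  fix d
  \<comment> \<open>Inserting \<open>d\<close> guarantees that the one surviving index belongs to
    the index set, even when \<open>f d\<close> is zero.\<close>
  have "linear_extension R (\<lambda>x. x) f d =
      (\<Oplus>b\<in>insert d {a. f a \<noteq> \<zero>}. if b = d then f b else \<zero>)"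
    using f by (intro linear_extension_eq) (auto simp: free_algebra_carrierD)
  also have "\<dots> = f d"
    using free_algebra_carrierD(1,3)[OF f] by (intro add.finprod_singleton_swap) auto
  finally show "linear_extension R (\<lambda>x. x) f d = f d" .
qed

section \<open>Bilinearity of the product\<close>

lemma free_algebra_mult_l_distr:
  assumes f: "f \<in> carrier (free_algebra R B c)" and f': "f' \<in> carrier (free_algebra R B c)"
    and g: "g \<in> carrier (free_algebra R B c)"
  shows "(f \<oplus>\<^bsub>free_algebra R B c\<^esub> f') \<otimes>\<^bsub>free_algebra R B c\<^esub> g =
    f \<otimes>\<^bsub>free_algebra R B c\<^esub> g \<oplus>\<^bsub>free_algebra R B c\<^esub> f' \<otimes>\<^bsub>free_algebra R B c\<^esub> g" (is "?l = ?r")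
proof
  fix d
  \<comment> \<open>Coefficients may cancel, so the support of the sum can be smaller than this
    union; all three products are expanded over the union.\<close>
  let ?A = "{a. f a \<noteq> \<zero>} \<union> {a. f' a \<noteq> \<zero>}" and ?C = "{a. g a \<noteq> \<zero>}"
  interpret F: abelian_group "free_algebra R B c" by (rule abelian_group_free_algebra)
  note [simp] = free_algebra_carrierD(1)[OF f] free_algebra_carrierD(1)[OF g] free_algebra_carrierD(1)[OF f']
  have A: "finite ?A" "finite ?C"
    using f f' g by (auto simp: free_algebra_carrierD(3))
  have "?l d = finsum R (\<lambda>(a, b).
      if c a b = Some d then (f \<oplus>\<^bsub>free_algebra R B c\<^esub> f') a \<otimes> g b else \<zero>) (?A \<times> ?C)"
    using f f' g A by (intro free_algebra_mult_eq F.a_closed) (auto simp: free_algebra_add_apply)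
  also have "\<dots> = (\<Oplus>z\<in>?A \<times> ?C. (case z of (a, b) \<Rightarrow> if c a b = Some d then f a \<otimes> g b else \<zero>) \<oplus>
      (case z of (a, b) \<Rightarrow> if c a b = Some d then f' a \<otimes> g b else \<zero>))"
    by (intro finsum_cong') (auto simp: free_algebra_add_apply l_distr)
  also have "\<dots> = finsum R (\<lambda>(a, b). if c a b = Some d then f a \<otimes> g b else \<zero>) (?A \<times> ?C) \<oplus>
      finsum R (\<lambda>(a, b). if c a b = Some d then f' a \<otimes> g b else \<zero>) (?A \<times> ?C)"
    by (intro finsum_addf) auto
  also have "\<dots> = ?r d"
    using f f' g A by (simp add: free_algebra_add_apply free_algebra_mult_eq[where A = ?A and C = ?C])
  finally show "?l d = ?r d" .
qed

lemma free_algebra_mult_r_distr: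
  assumes f: "f \<in> carrier (free_algebra R B c)" and f': "f' \<in> carrier (free_algebra R B c)"
    and g: "g \<in> carrier (free_algebra R B c)"
  shows "g \<otimes>\<^bsub>free_algebra R B c\<^esub> (f \<oplus>\<^bsub>free_algebra R B c\<^esub> f') =
    g \<otimes>\<^bsub>free_algebra R B c\<^esub> f \<oplus>\<^bsub>free_algebra R B c\<^esub> g \<otimes>\<^bsub>free_algebra R B c\<^esub> f'" (is "?l = ?r")
proof
  fix d
  let ?A = "{a. f a \<noteq> \<zero>} \<union> {a. f' a \<noteq> \<zero>}" and ?C = "{a. g a \<noteq> \<zero>}"
  interpret F: abelian_group "free_algebra R B c" by (rule abelian_group_free_algebra)
  note [simp] = free_algebra_carrierD(1)[OF f] free_algebra_carrierD(1)[OF g] free_algebra_carrierD(1)[OF f']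
  have A: "finite ?A" "finite ?C"
    using f f' g by (auto simp: free_algebra_carrierD(3))
  have "?l d = finsum R (\<lambda>(a, b).
      if c a b = Some d then g a \<otimes> (f \<oplus>\<^bsub>free_algebra R B c\<^esub> f') b else \<zero>) (?C \<times> ?A)"
    using f f' g A by (intro free_algebra_mult_eq F.a_closed) (auto simp: free_algebra_add_apply)
  also have "\<dots> = (\<Oplus>z\<in>?C \<times> ?A. (case z of (a, b) \<Rightarrow> if c a b = Some d then g a \<otimes> f b else \<zero>) \<oplus>
      (case z of (a, b) \<Rightarrow> if c a b = Some d then g a \<otimes> f' b else \<zero>))"
    by (intro finsum_cong') (auto simp: free_algebra_add_apply r_distr)
  also have "\<dots> = finsum R (\<lambda>(a, b). if c a b = Some d then g a \<otimes> f b else \<zero>) (?C \<times> ?A) \<oplus>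
      finsum R (\<lambda>(a, b). if c a b = Some d then g a \<otimes> f' b else \<zero>) (?C \<times> ?A)"
    by (intro finsum_addf) auto
  also have "\<dots> = ?r d"
    using f f' g A by (simp add: free_algebra_add_apply free_algebra_mult_eq[where A = ?C and C = ?A])
  finally show "?l d = ?r d" .
qed

lemma free_algebra_smult_mult:
  assumes r: "r \<in> carrier R"
    and f: "f \<in> carrier (free_algebra R B c)" and g: "g \<in> carrier (free_algebra R B c)"
  shows "(r \<odot>\<^bsub>free_algebra R B c\<^esub> f) \<otimes>\<^bsub>free_algebra R B c\<^esub> g =
      r \<odot>\<^bsub>free_algebra R B c\<^esub> (f \<otimes>\<^bsub>free_algebra R B c\<^esub> g)" (is "?l = ?r")
    and "f \<otimes>\<^bsub>free_algebra R B c\<^esub> (r \<odot>\<^bsub>free_algebra R B c\<^esub> g) =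
      r \<odot>\<^bsub>free_algebra R B c\<^esub> (f \<otimes>\<^bsub>free_algebra R B c\<^esub> g)" (is "?l' = _")
proof -
  let ?A = "{a. f a \<noteq> \<zero>}" and ?C = "{a. g a \<noteq> \<zero>}"
  interpret F: module R "free_algebra R B c" by (rule module_free_algebra)
  note [simp] = free_algebra_carrierD(1)[OF f] free_algebra_carrierD(1)[OF g] r
  have A: "finite ?A" "finite ?C"
    using f g by (auto simp: free_algebra_carrierD(3))
  have r_eq: "?r d = (\<Oplus>z\<in>?A \<times> ?C. r \<otimes> (case z of (a, b) \<Rightarrow> if c a b = Some d then f a \<otimes> g b else \<zero>))" for d
    using f g A by (simp add: free_algebra_smult_apply free_algebra_mult_eq[where A = ?A and C = ?C])
      (intro finsum_rdistr, auto)
  show "?l = ?r"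
  proof
    fix d
    have "?l d = finsum R (\<lambda>(a, b).
        if c a b = Some d then (r \<odot>\<^bsub>free_algebra R B c\<^esub> f) a \<otimes> g b else \<zero>) (?A \<times> ?C)"
      using f g A by (intro free_algebra_mult_eq F.smult_closed) (auto simp: free_algebra_smult_apply)
    also have "\<dots> = ?r d"
      unfolding r_eq by (intro finsum_cong') (auto simp: free_algebra_smult_apply m_assoc)
    finally show "?l d = ?r d" .
  qed
  show "?l' = ?r"
  proof
    fix d
    have "?l' d = finsum R (\<lambda>(a, b).
        if c a b = Some d then f a \<otimes> (r \<odot>\<^bsub>free_algebra R B c\<^esub> g) b else \<zero>) (?A \<times> ?C)"
      using f g A by (intro free_algebra_mult_eq F.smult_closed) (auto simp: free_algebra_smult_apply)
    also have "\<dots> = ?r d"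
      unfolding r_eq by (intro finsum_cong') (auto simp: free_algebra_smult_apply m_lcomm)
    finally show "?l' d = ?r d" .
  qed
qed

lemma free_algebra_zero_mult:
  shows "\<zero>\<^bsub>free_algebra R B c\<^esub> \<otimes>\<^bsub>free_algebra R B c\<^esub> f = \<zero>\<^bsub>free_algebra R B c\<^esub>"
    and "f \<otimes>\<^bsub>free_algebra R B c\<^esub> \<zero>\<^bsub>free_algebra R B c\<^esub> = \<zero>\<^bsub>free_algebra R B c\<^esub>"
  by (simp_all add: free_algebra_def)

end

section \<open>The algebra of a partial semigroup\<close>

context partial_semigroup
begin

text \<open>By distributivity, induction in both factors reduces to products of generators, each of
  which is zero or again a generator. Finiteness of the support thus needs no separate
  argument.\<close>

lemma free_algebra_mult_closed:
  assumes "cring R" and f: "f \<in> carrier (free_algebra R B c)" and g: "g \<in> carrier (free_algebra R B c)"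
  shows "f \<otimes>\<^bsub>free_algebra R B c\<^esub> g \<in> carrier (free_algebra R B c)"
proof -
  let ?F = "free_algebra R B c"
  interpret cring R by fact
  interpret F: abelian_group ?F by (rule abelian_group_free_algebra)
  have *: "single R r a \<otimes>\<^bsub>?F\<^esub> single R s b \<in> carrier ?F"
    if "r \<in> carrier R" "s \<in> carrier R" "a \<in> B" "b \<in> B" for r s a b
    using that by (auto simp: free_algebra_mult_single intro: single_closed closed split: option.split)
  show ?thesis
    using f
  proof (induction rule: free_algebra_induct)
    case zero
    then show ?case
      by (simp add: free_algebra_zero_mult g)
  next
    case (add r a f)
    have "single R r a \<otimes>\<^bsub>?F\<^esub> g \<in> carrier ?F"
      using g
    proof (induction rule: free_algebra_induct)
      case zero
      then show ?case
        by (simp add: free_algebra_zero_mult single_closed add)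
    next
      case (add s b g)
      then show ?case
        using * \<open>r \<in> carrier R\<close> \<open>a \<in> B\<close>
        by (simp add: free_algebra_mult_r_distr single_closed)
    qed
    with add g show ?case
      by (simp add: free_algebra_mult_l_distr single_closed)
  qed
qed

text \<open>Both bracketings are additive in each factor, so three uses of
  \<open>free_algebra_ext\<close>, one per factor, reduce the claim to generators. There it is
  \<open>assoc\<close>, with zero in the role of \<open>None\<close>.\<close>

lemma free_algebra_mult_assoc:
  assumes "cring R" and f: "f \<in> carrier (free_algebra R B c)" and g: "g \<in> carrier (free_algebra R B c)"
    and h: "h \<in> carrier (free_algebra R B c)"
  shows "(f \<otimes>\<^bsub>free_algebra R B c\<^esub> g) \<otimes>\<^bsub>free_algebra R B c\<^esub> h =
    f \<otimes>\<^bsub>free_algebra R B c\<^esub> (g \<otimes>\<^bsub>free_algebra R B c\<^esub> h)"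
proof -
  interpret cring R by fact
  let ?F = "free_algebra R B c"
  note distr = free_algebra_mult_l_distr free_algebra_mult_r_distr
  note cl = free_algebra_mult_closed[OF \<open>cring R\<close>] single_closed
  interpret F: abelian_group ?F by (rule abelian_group_free_algebra)
  have 0: "(single R r a \<otimes>\<^bsub>?F\<^esub> single R s b) \<otimes>\<^bsub>?F\<^esub> single R t d =
      single R r a \<otimes>\<^bsub>?F\<^esub> (single R s b \<otimes>\<^bsub>?F\<^esub> single R t d)"
    if "r \<in> carrier R" "s \<in> carrier R" "t \<in> carrier R" "a \<in> B" "b \<in> B" "d \<in> B" for r s t a b d
    using that assoc[OF that(4,5,6)] closed[OF that(4,5)] closed[OF that(5,6)]
    by (cases "c a b"; cases "c b d")
      (simp_all add: free_algebra_mult_single free_algebra_zero_mult m_assoc split: option.splits)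
  have 1: "(single R r a \<otimes>\<^bsub>?F\<^esub> single R s b) \<otimes>\<^bsub>?F\<^esub> h =
      single R r a \<otimes>\<^bsub>?F\<^esub> (single R s b \<otimes>\<^bsub>?F\<^esub> h)"
    if "r \<in> carrier R" "s \<in> carrier R" "a \<in> B" "b \<in> B" for r s a b
    by (rule free_algebra_ext[OF abelian_group_free_algebra[of B c] _ _ _ _ _ h])
      (use that 0 in \<open>auto simp: distr cl\<close>)
  have 2: "(single R r a \<otimes>\<^bsub>?F\<^esub> g) \<otimes>\<^bsub>?F\<^esub> h = single R r a \<otimes>\<^bsub>?F\<^esub> (g \<otimes>\<^bsub>?F\<^esub> h)"
    if "r \<in> carrier R" "a \<in> B" for r a
    by (rule free_algebra_ext[OF abelian_group_free_algebra[of B c] _ _ _ _ _ g])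
      (use that 1 h in \<open>auto simp: distr cl\<close>)
  show ?thesis
    by (rule free_algebra_ext[OF abelian_group_free_algebra[of B c] _ _ _ _ _ f])
      (use 2 g h in \<open>auto simp: distr cl\<close>)
qed

lemma nonunital_algebra_free_algebra:
  assumes "cring R"
  shows "nonunital_algebra R (free_algebra R B c)"
proof -
  interpret cring R by fact
  show ?thesis
    by (intro nonunital_algebra.intro nonunital_algebra_axioms.intro module_free_algebra
        free_algebra_mult_closed[OF assms] free_algebra_mult_assoc[OF assms] free_algebra_smult_mult
        free_algebra_mult_l_distr free_algebra_mult_r_distr)
qed

end

text \<open>Multiplicativity is an identity additive in each factor, hence tested on generators.
  There the two products are either both undefined, giving zero on each side, or correspond under
  \<open>h\<close>.\<close>

lemma linear_extension_algebra_hom: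
  assumes "cring R" "partial_semigroup B c" "partial_semigroup D e"
    and h: "h \<in> partial_semigroup_hom B c D e"
  shows "linear_extension R h \<in> algebra_hom R (free_algebra R B c) (free_algebra R D e)"
proof -
  interpret cring R by fact
  interpret B: partial_semigroup B c by fact
  interpret D: partial_semigroup D e by fact
  let ?F = "free_algebra R B c" and ?E = "free_algebra R D e" and ?l = "linear_extension R h"
  have hBD: "h \<in> B \<rightarrow> D"
    using h by (simp add: partial_semigroup_hom_def)
  note cl = B.free_algebra_mult_closed[OF \<open>cring R\<close>] D.free_algebra_mult_closed[OF \<open>cring R\<close>]
    single_closed linear_extension_closed[OF hBD, where c = c and e = e]
  note distr = free_algebra_mult_l_distr free_algebra_mult_r_distr
    linear_extension_add[where B = B and c = c and D = D and e = e]
  interpret F: abelian_group ?F by (rule abelian_group_free_algebra)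
  interpret E: abelian_group ?E by (rule abelian_group_free_algebra)
  have zero: "?l \<zero>\<^bsub>?F\<^esub> = \<zero>\<^bsub>?E\<^esub>"
    by (auto simp: linear_extension_def free_algebra_def)
  have 0: "?l (single R r a \<otimes>\<^bsub>?F\<^esub> single R s b) = ?l (single R r a) \<otimes>\<^bsub>?E\<^esub> ?l (single R s b)"
    if "r \<in> carrier R" "s \<in> carrier R" "a \<in> B" "b \<in> B" for r s a b
  proof -
    have "e (h a) (h b) = map_option h (c a b)"
      using h that by (simp add: partial_semigroup_hom_def)
    with that hBD B.closed[OF that(3,4)] show ?thesis
      by (auto simp: linear_extension_single[where B = B] free_algebra_mult_single zero Pi_iff
          split: option.split)
  qed
  have 1: "?l (single R r a \<otimes>\<^bsub>?F\<^esub> g) = ?l (single R r a) \<otimes>\<^bsub>?E\<^esub> ?l g"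
    if "r \<in> carrier R" "a \<in> B" "g \<in> carrier ?F" for r a g
    by (rule free_algebra_ext[OF abelian_group_free_algebra[of D e] _ _ _ _ _ that(3)])
      (use that 0 in \<open>auto simp: distr cl\<close>)
  have "?l (f \<otimes>\<^bsub>?F\<^esub> g) = ?l f \<otimes>\<^bsub>?E\<^esub> ?l g" if "f \<in> carrier ?F" "g \<in> carrier ?F" for f g
    by (rule free_algebra_ext[OF abelian_group_free_algebra[of D e] _ _ _ _ _ that(1)])
      (use that 1 in \<open>auto simp: distr cl\<close>)
  then show ?thesis
    by (auto simp: algebra_hom_def cl distr
        linear_extension_smult[where B = B and c = c and D = D and e = e])
qed

lemma bij_betw_linear_extension:
  assumes "cring R" and h: "h \<in> B \<rightarrow> D" and k: "k \<in> D \<rightarrow> B"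
    and kh: "\<And>b. b \<in> B \<Longrightarrow> k (h b) = b" and hk: "\<And>d. d \<in> D \<Longrightarrow> h (k d) = d"
  shows "bij_betw (linear_extension R h) (carrier (free_algebra R B c)) (carrier (free_algebra R D e))"
proof -
  interpret cring R by fact
  have "linear_extension R k (linear_extension R h f) = f" if f: "f \<in> carrier (free_algebra R B c)" for f
  proof -
    have "linear_extension R k (linear_extension R h f) = linear_extension R (\<lambda>x. x) f"
      unfolding linear_extension_compose[OF h f] using kh
      by (intro linear_extension_cong[OF _ f]) auto
    with f show ?thesis
      by (simp add: linear_extension_id)
  qed
  moreover have "linear_extension R h (linear_extension R k f) = f" if f: "f \<in> carrier (free_algebra R D e)" for f
  proof -
    have "linear_extension R h (linear_extension R k f) = linear_extension R (\<lambda>x. x) f"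
      unfolding linear_extension_compose[OF k f] using hk
      by (intro linear_extension_cong[OF _ f]) auto
    with f show ?thesis
      by (simp add: linear_extension_id)
  qed
  ultimately show ?thesis
    using h k by (intro bij_betw_byWitness[where f' = "linear_extension R k"])
      (auto intro: linear_extension_closed[where B = B and c = c] linear_extension_closed[where B = D and c = e])
qed

section \<open>Quotients of non-unital algebras\<close>

lemma algebra_homD:
  assumes "h \<in> algebra_hom R A B"
  shows "x \<in> carrier A \<Longrightarrow> h x \<in> carrier B"
    and "\<lbrakk>x \<in> carrier A; y \<in> carrier A\<rbrakk> \<Longrightarrow> h (x \<oplus>\<^bsub>A\<^esub> y) = h x \<oplus>\<^bsub>B\<^esub> h y"
    and "\<lbrakk>x \<in> carrier A; y \<in> carrier A\<rbrakk> \<Longrightarrow> h (x \<otimes>\<^bsub>A\<^esub> y) = h x \<otimes>\<^bsub>B\<^esub> h y"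
    and "\<lbrakk>a \<in> carrier R; x \<in> carrier A\<rbrakk> \<Longrightarrow> h (a \<odot>\<^bsub>A\<^esub> x) = a \<odot>\<^bsub>B\<^esub> h x"
  using assms by (auto simp: algebra_hom_def)

context nonunital_algebra
begin

lemma zero_mult:
  assumes "x \<in> carrier M"
  shows "\<zero>\<^bsub>M\<^esub> \<otimes>\<^bsub>M\<^esub> x = \<zero>\<^bsub>M\<^esub>"
  using mult_l_distr[of "\<zero>\<^bsub>M\<^esub>" "\<zero>\<^bsub>M\<^esub>" x] assms
  by (metis M.add.l_cancel_one M.zero_closed M.l_zero mult_closed)

lemma mult_zero:
  assumes "x \<in> carrier M"
  shows "x \<otimes>\<^bsub>M\<^esub> \<zero>\<^bsub>M\<^esub> = \<zero>\<^bsub>M\<^esub>"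
  using mult_r_distr[of "\<zero>\<^bsub>M\<^esub>" "\<zero>\<^bsub>M\<^esub>" x] assms
  by (metis M.add.l_cancel_one M.zero_closed M.l_zero mult_closed)

lemma algebra_hom_zero:
  assumes "h \<in> algebra_hom R M N" "nonunital_algebra R N"
  shows "h \<zero>\<^bsub>M\<^esub> = \<zero>\<^bsub>N\<^esub>"
proof -
  interpret N: nonunital_algebra R N by fact
  have "h \<zero>\<^bsub>M\<^esub> \<oplus>\<^bsub>N\<^esub> h \<zero>\<^bsub>M\<^esub> = h \<zero>\<^bsub>M\<^esub>"
    using algebra_homD(2)[OF assms(1), of "\<zero>\<^bsub>M\<^esub>" "\<zero>\<^bsub>M\<^esub>"] by simp
  then show ?thesis
    using algebra_homD(1)[OF assms(1), of "\<zero>\<^bsub>M\<^esub>"] by simp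
qed

lemma nonunital_algebra_subalgebra:
  assumes Z: "Z \<subseteq> carrier M" "\<zero>\<^bsub>M\<^esub> \<in> Z"
    and add: "\<And>x y. \<lbrakk>x \<in> Z; y \<in> Z\<rbrakk> \<Longrightarrow> x \<oplus>\<^bsub>M\<^esub> y \<in> Z"
    and mult: "\<And>x y. \<lbrakk>x \<in> Z; y \<in> Z\<rbrakk> \<Longrightarrow> x \<otimes>\<^bsub>M\<^esub> y \<in> Z"
    and smult: "\<And>a x. \<lbrakk>a \<in> carrier R; x \<in> Z\<rbrakk> \<Longrightarrow> a \<odot>\<^bsub>M\<^esub> x \<in> Z"
  shows "nonunital_algebra R (M\<lparr>carrier := Z\<rparr>)"
proof -
  have Z': "x \<in> carrier M" if "x \<in> Z" for x
    using Z that by blast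
  \<comment> \<open>The additive inverse is (-1) x, so closure of \<open>Z\<close> under scalars
    already provides it.\<close>
  have inv: "\<exists>y\<in>Z. y \<oplus>\<^bsub>M\<^esub> x = \<zero>\<^bsub>M\<^esub>" if "x \<in> Z" for x
  proof
    have "(\<ominus> \<one>) \<odot>\<^bsub>M\<^esub> x \<oplus>\<^bsub>M\<^esub> \<one> \<odot>\<^bsub>M\<^esub> x = (\<ominus> \<one> \<oplus> \<one>) \<odot>\<^bsub>M\<^esub> x"
      using Z'[OF that] by (simp add: smult_l_distr del: smult_one)
    also have "\<dots> = \<zero> \<odot>\<^bsub>M\<^esub> x"
      by (simp add: R.l_neg)
    finally show "(\<ominus> \<one>) \<odot>\<^bsub>M\<^esub> x \<oplus>\<^bsub>M\<^esub> x = \<zero>\<^bsub>M\<^esub>"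
      using Z'[OF that] by simp
    show "(\<ominus> \<one>) \<odot>\<^bsub>M\<^esub> x \<in> Z"
      using that by (simp add: smult)
  qed
  have "abelian_group (M\<lparr>carrier := Z\<rparr>)"
    by (rule abelian_groupI) (auto simp: Z' Z(2) add inv M.a_assoc intro: M.a_comm)
  then have "module R (M\<lparr>carrier := Z\<rparr>)"
    by (intro moduleI) (auto simp: Z' smult smult_l_distr smult_r_distr smult_assoc1 R.is_cring)
  then show ?thesis
    by (intro nonunital_algebra.intro nonunital_algebra_axioms.intro)
      (auto simp: Z' mult mult_assoc mult_l_distr mult_r_distr smult_mult_l smult_mult_r)
qed

end

text \<open>Stability under scalars is an axiom of its own: without a unit, a scalar multiple of x
  need not be a product of x with an element of the algebra.\<close>

locale algebra_ideal = nonunital_algebra R A + additive_subgroup I A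
  for R (structure) and A (structure) and I +
  assumes ideal_mult_l: "\<lbrakk>x \<in> I; y \<in> carrier A\<rbrakk> \<Longrightarrow> x \<otimes>\<^bsub>A\<^esub> y \<in> I"
    and ideal_mult_r: "\<lbrakk>x \<in> carrier A; y \<in> I\<rbrakk> \<Longrightarrow> x \<otimes>\<^bsub>A\<^esub> y \<in> I"
    and ideal_smult: "\<lbrakk>a \<in> carrier R; x \<in> I\<rbrakk> \<Longrightarrow> a \<odot>\<^bsub>A\<^esub> x \<in> I"
begin

sublocale abelian_subgroup I A
  by (intro abelian_subgroupI3 is_additive_subgroup M.abelian_group_axioms)

lemma coset_eqI:
  assumes "h \<in> I" "x \<in> carrier A"
  shows "I +>\<^bsub>A\<^esub> (h \<oplus>\<^bsub>A\<^esub> x) = I +>\<^bsub>A\<^esub> x"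
  using M.a_repr_independence[OF M.a_rcosI _ a_subgroup] assms a_subset by metis

lemma in_cosetE:
  assumes "z \<in> I +>\<^bsub>A\<^esub> x"
  obtains h where "h \<in> I" "z = h \<oplus>\<^bsub>A\<^esub> x"
  using assms by (auto simp: a_r_coset_def')

text \<open>\<open>rcoset_mult\<close> is a union over all pairs of representatives, so independence
  of the representatives is what collapses it to one coset.\<close>

lemma rcoset_mult_coset:
  assumes x: "x \<in> carrier A" and y: "y \<in> carrier A"
  shows "rcoset_mult A I (I +>\<^bsub>A\<^esub> x) (I +>\<^bsub>A\<^esub> y) = I +>\<^bsub>A\<^esub> (x \<otimes>\<^bsub>A\<^esub> y)"
proof -
  have *: "I +>\<^bsub>A\<^esub> (x' \<otimes>\<^bsub>A\<^esub> y') = I +>\<^bsub>A\<^esub> (x \<otimes>\<^bsub>A\<^esub> y)"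
    if x': "x' \<in> I +>\<^bsub>A\<^esub> x" and y': "y' \<in> I +>\<^bsub>A\<^esub> y" for x' y'
  proof -
    obtain h where h: "h \<in> I" "x' = h \<oplus>\<^bsub>A\<^esub> x"
      using x' by (rule in_cosetE)
    obtain k where k: "k \<in> I" "y' = k \<oplus>\<^bsub>A\<^esub> y"
      using y' by (rule in_cosetE)
    have c: "h \<in> carrier A" "k \<in> carrier A"
      using h k a_subset by auto
    \<comment> \<open>Leaving y' unexpanded in the first summand keeps the error to two terms, one
      for each side of the ideal property.\<close>
    then have "x' \<otimes>\<^bsub>A\<^esub> y' = (h \<otimes>\<^bsub>A\<^esub> y' \<oplus>\<^bsub>A\<^esub> x \<otimes>\<^bsub>A\<^esub> k) \<oplus>\<^bsub>A\<^esub> x \<otimes>\<^bsub>A\<^esub> y"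
      using x y by (simp add: h k mult_l_distr mult_r_distr mult_closed M.a_ac)
    moreover have "h \<otimes>\<^bsub>A\<^esub> y' \<oplus>\<^bsub>A\<^esub> x \<otimes>\<^bsub>A\<^esub> k \<in> I"
      using h k c x y by (simp add: ideal_mult_l ideal_mult_r)
    ultimately show ?thesis
      using x y by (simp add: coset_eqI mult_closed)
  qed
  have "x \<in> I +>\<^bsub>A\<^esub> x" "y \<in> I +>\<^bsub>A\<^esub> y"
    using x y by (simp_all add: a_rcos_self)
  with * show ?thesis
    unfolding rcoset_mult_def by blast
qed

lemma smult_coset:
  assumes a: "a \<in> carrier R" and x: "x \<in> carrier A"
  shows "(\<Union>x'\<in>I +>\<^bsub>A\<^esub> x. I +>\<^bsub>A\<^esub> (a \<odot>\<^bsub>A\<^esub> x')) = I +>\<^bsub>A\<^esub> (a \<odot>\<^bsub>A\<^esub> x)"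
proof -
  have "I +>\<^bsub>A\<^esub> (a \<odot>\<^bsub>A\<^esub> x') = I +>\<^bsub>A\<^esub> (a \<odot>\<^bsub>A\<^esub> x)" if x': "x' \<in> I +>\<^bsub>A\<^esub> x" for x'
  proof -
    obtain h where h: "h \<in> I" "x' = h \<oplus>\<^bsub>A\<^esub> x"
      using x' by (rule in_cosetE)
    moreover from h have "h \<in> carrier A"
      using a_subset by auto
    ultimately show ?thesis
      using a x by (simp add: smult_r_distr coset_eqI ideal_smult)
  qed
  moreover have "x \<in> I +>\<^bsub>A\<^esub> x"
    using x by (simp add: a_rcos_self)
  ultimately show ?thesis
    by blast
qed

lemma carrier_quotient_algebra: "carrier (quotient_algebra A I) = (\<lambda>x. I +>\<^bsub>A\<^esub> x) ` carrier A"
  by (auto simp: quotient_algebra_def A_RCOSETS_def')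

lemma quotient_algebra_ops:
  shows "\<zero>\<^bsub>quotient_algebra A I\<^esub> = I +>\<^bsub>A\<^esub> \<zero>\<^bsub>A\<^esub>"
    and "\<lbrakk>x \<in> carrier A; y \<in> carrier A\<rbrakk> \<Longrightarrow>
      (I +>\<^bsub>A\<^esub> x) \<oplus>\<^bsub>quotient_algebra A I\<^esub> (I +>\<^bsub>A\<^esub> y) = I +>\<^bsub>A\<^esub> (x \<oplus>\<^bsub>A\<^esub> y)"
    and "\<lbrakk>x \<in> carrier A; y \<in> carrier A\<rbrakk> \<Longrightarrow>
      (I +>\<^bsub>A\<^esub> x) \<otimes>\<^bsub>quotient_algebra A I\<^esub> (I +>\<^bsub>A\<^esub> y) = I +>\<^bsub>A\<^esub> (x \<otimes>\<^bsub>A\<^esub> y)"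
    and "\<lbrakk>a \<in> carrier R; x \<in> carrier A\<rbrakk> \<Longrightarrow>
      a \<odot>\<^bsub>quotient_algebra A I\<^esub> (I +>\<^bsub>A\<^esub> x) = I +>\<^bsub>A\<^esub> (a \<odot>\<^bsub>A\<^esub> x)"
  using a_subset
  by (simp_all add: quotient_algebra_def rcoset_mult_coset smult_coset a_rcos_sum)

text \<open>The rules \<open>quotient_algebra_ops\<close> make passage to cosets compatible with all
  operations, so each law is the image of the corresponding law in \<open>A\<close>.\<close>

lemma nonunital_algebra_quotient: "nonunital_algebra R (quotient_algebra A I)"
proof -
  let ?Q = "quotient_algebra A I"
  have "abelian_group ?Q"
  proof (rule abelian_groupI)
    show "\<exists>Y\<in>carrier ?Q. Y \<oplus>\<^bsub>?Q\<^esub> X = \<zero>\<^bsub>?Q\<^esub>" if X: "X \<in> carrier ?Q" for X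
    proof -
      obtain x where x: "x \<in> carrier A" "X = I +>\<^bsub>A\<^esub> x"
        using X by (auto simp: carrier_quotient_algebra)
      then show ?thesis
        by (intro bexI[of _ "I +>\<^bsub>A\<^esub> (\<ominus>\<^bsub>A\<^esub> x)"])
          (auto simp: quotient_algebra_ops M.l_neg carrier_quotient_algebra)
    qed
  qed (auto simp: carrier_quotient_algebra quotient_algebra_ops M.a_ac)
  then have "module R ?Q"
    by (intro moduleI) (auto simp: carrier_quotient_algebra quotient_algebra_ops smult_l_distr
        smult_r_distr smult_assoc1 R.is_cring)
  then show ?thesis
    by (intro nonunital_algebra.intro nonunital_algebra_axioms.intro)
      (auto simp: carrier_quotient_algebra quotient_algebra_ops mult_closed mult_assoc mult_l_distr
        mult_r_distr smult_mult_l smult_mult_r)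
qed

end

text \<open>The isomorphism is the direct image of cosets. Since \<open>h\<close> carries
  \<open>I\<close> onto \<open>J\<close>, it carries the coset of x onto the coset of
  \<open>h x\<close>; taking images of subsets of \<open>carrier A\<close> is injective because
  \<open>h\<close> is.\<close>

lemma isomorphic_quotient_algebras:
  assumes A: "algebra_ideal R A I" and B: "algebra_ideal R B J"
    and h: "h \<in> algebra_hom R A B" and bij: "bij_betw h (carrier A) (carrier B)" and hI: "h ` I = J"
  shows "isomorphic_algebras R (quotient_algebra A I) (quotient_algebra B J)"
proof -
  interpret A: algebra_ideal R A I by fact
  interpret B: algebra_ideal R B J by fact
  note hom = algebra_homD[OF h]
  have img: "h ` (I +>\<^bsub>A\<^esub> x) = J +>\<^bsub>B\<^esub> h x" if "x \<in> carrier A" for x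
  proof -
    have "h ` (I +>\<^bsub>A\<^esub> x) = (\<lambda>i. h i \<oplus>\<^bsub>B\<^esub> h x) ` I"
      unfolding a_r_coset_def' using that A.a_subset by (force simp: hom image_iff)
    also have "\<dots> = J +>\<^bsub>B\<^esub> h x"
      unfolding a_r_coset_def' hI[symmetric] by auto
    finally show ?thesis .
  qed
  have "image h \<in> algebra_hom R (quotient_algebra A I) (quotient_algebra B J)"
    by (auto simp: algebra_hom_def A.carrier_quotient_algebra B.carrier_quotient_algebra
        A.quotient_algebra_ops B.quotient_algebra_ops img hom A.mult_closed)
  moreover have "bij_betw (image h) (carrier (quotient_algebra A I)) (carrier (quotient_algebra B J))"
    unfolding bij_betw_def
  proof
    have "C \<subseteq> carrier A" if "C \<in> carrier (quotient_algebra A I)" for C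
      using that A.a_subset A.M.a_r_coset_subset_G by (auto simp: A.carrier_quotient_algebra)
    then show "inj_on (image h) (carrier (quotient_algebra A I))"
      using bij by (intro inj_onI) (metis bij_betw_imp_inj_on inj_on_image_eq_iff)
    have "image h ` carrier (quotient_algebra A I) = (\<lambda>x. J +>\<^bsub>B\<^esub> h x) ` carrier A"
      by (force simp: A.carrier_quotient_algebra img image_iff)
    also have "\<dots> = (\<lambda>x. J +>\<^bsub>B\<^esub> x) ` (h ` carrier A)"
      by auto
    finally show "image h ` carrier (quotient_algebra A I) = carrier (quotient_algebra B J)"
      using bij by (simp add: B.carrier_quotient_algebra bij_betw_def)
  qed
  ultimately show ?thesis
    unfolding isomorphic_algebras_def
    using A.nonunital_algebra_quotient B.nonunital_algebra_quotient by blast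
qed

section \<open>Moore homology\<close>

text \<open>\<open>face_face\<close> is the simplicial identity behind the vanishing of the square
  of the differential. \<open>face_degen\<close> lets the last face undo the last degeneracy, so
  that a factor in degree n can be lifted to degree n + 1.\<close>

locale moore_algebra = cring R
  for R :: "('r, 'x) ring_scheme" (structure) and S :: "('r, 'm) simplicial_data" +
  assumes level: "nonunital_algebra R (level S n)"
    and face_hom: "j \<le> Suc n \<Longrightarrow> face S (Suc n) j \<in> algebra_hom R (level S (Suc n)) (level S n)"
    and degen_hom: "degen S n n \<in> algebra_hom R (level S n) (level S (Suc n))"
    and face_degen: "x \<in> carrier (level S n) \<Longrightarrow> face S (Suc n) (Suc n) (degen S n n x) = x"
    and face_face: "\<lbrakk>j \<le> Suc n; x \<in> carrier (level S (Suc (Suc n)))\<rbrakk> \<Longrightarrow>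
      face S (Suc n) j (face S (Suc (Suc n)) (Suc (Suc n)) x) =
      face S (Suc n) (Suc n) (face S (Suc (Suc n)) j x)"
begin

section \<open>The differential, cycles and boundaries\<close>

lemmas faceD = algebra_homD[OF face_hom]
lemmas degenD = algebra_homD[OF degen_hom]

lemma face_zero: "j \<le> Suc n \<Longrightarrow> face S (Suc n) j \<zero>\<^bsub>level S (Suc n)\<^esub> = \<zero>\<^bsub>level S n\<^esub>"
  using nonunital_algebra.algebra_hom_zero[OF level face_hom level] .

lemma moore_diff_Suc:
  "moore_diff R S (Suc n) x = ((\<ominus> \<one>) [^] Suc n) \<odot>\<^bsub>level S n\<^esub> face S (Suc n) (Suc n) x"
  by (simp add: moore_diff_def)

lemma carrier_moore_Suc:
  "carrier (moore S (Suc n)) =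
    {x \<in> carrier (level S (Suc n)). \<forall>j\<le>n. face S (Suc n) j x = \<zero>\<^bsub>level S n\<^esub>}"
  by (auto simp: moore_def less_Suc_eq_le)

lemma carrier_moore_cycles_0: "carrier (moore_cycles R S 0) = carrier (level S 0)"
  by (simp add: moore_cycles_def moore_def moore_diff_def)

lemma carrier_moore_cycles_Suc:
  "carrier (moore_cycles R S (Suc n)) =
    {x \<in> carrier (moore S (Suc n)). moore_diff R S (Suc n) x = \<zero>\<^bsub>level S n\<^esub>}"
  by (simp add: moore_cycles_def)

lemma moore_cycles_eq: "moore_cycles R S n = (level S n)\<lparr>carrier := carrier (moore_cycles R S n)\<rparr>"
  by (simp add: moore_cycles_def moore_def)

lemma moore_diff_closed:
  assumes "x \<in> carrier (level S (Suc n))"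
  shows "moore_diff R S (Suc n) x \<in> carrier (level S n)"
proof -
  interpret L: nonunital_algebra R "level S n" by (rule level)
  show ?thesis
    using assms by (simp add: moore_diff_Suc faceD)
qed

lemma moore_diff_add:
  assumes "x \<in> carrier (level S (Suc n))" "y \<in> carrier (level S (Suc n))"
  shows "moore_diff R S (Suc n) (x \<oplus>\<^bsub>level S (Suc n)\<^esub> y) =
    moore_diff R S (Suc n) x \<oplus>\<^bsub>level S n\<^esub> moore_diff R S (Suc n) y"
proof -
  interpret L: nonunital_algebra R "level S n" by (rule level)
  show ?thesis
    using assms by (simp add: moore_diff_Suc faceD L.smult_r_distr)
qed

lemma moore_diff_smult:
  assumes "a \<in> carrier R" "x \<in> carrier (level S (Suc n))"
  shows "moore_diff R S (Suc n) (a \<odot>\<^bsub>level S (Suc n)\<^esub> x) = a \<odot>\<^bsub>level S n\<^esub> moore_diff R S (Suc n) x"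
proof -
  interpret L: nonunital_algebra R "level S n" by (rule level)
  show ?thesis
    using assms by (simp add: moore_diff_Suc faceD m_comm flip: L.smult_assoc1)
qed

lemma moore_diff_zero: "moore_diff R S (Suc n) \<zero>\<^bsub>level S (Suc n)\<^esub> = \<zero>\<^bsub>level S n\<^esub>"
proof -
  interpret L: nonunital_algebra R "level S n" by (rule level)
  show ?thesis
    by (simp add: moore_diff_Suc face_zero)
qed

text \<open>The last face is multiplicative and returns \<open>y\<close> from its degeneracy, while
  the sign is a scalar and moves to the factor coming from \<open>x\<close>.\<close>

lemma moore_diff_degen_mult:
  assumes "x \<in> carrier (level S (Suc n))" "y \<in> carrier (level S n)"
  shows "moore_diff R S (Suc n) (degen S n n y \<otimes>\<^bsub>level S (Suc n)\<^esub> x) =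
      y \<otimes>\<^bsub>level S n\<^esub> moore_diff R S (Suc n) x"
    and "moore_diff R S (Suc n) (x \<otimes>\<^bsub>level S (Suc n)\<^esub> degen S n n y) =
      moore_diff R S (Suc n) x \<otimes>\<^bsub>level S n\<^esub> y"
proof -
  interpret L: nonunital_algebra R "level S n" by (rule level)
  show "moore_diff R S (Suc n) (degen S n n y \<otimes>\<^bsub>level S (Suc n)\<^esub> x) =
      y \<otimes>\<^bsub>level S n\<^esub> moore_diff R S (Suc n) x"
    and "moore_diff R S (Suc n) (x \<otimes>\<^bsub>level S (Suc n)\<^esub> degen S n n y) =
      moore_diff R S (Suc n) x \<otimes>\<^bsub>level S n\<^esub> y"
    using assms
    by (simp_all add: moore_diff_Suc faceD degenD face_degen L.smult_mult_r L.smult_mult_l)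
qed

lemma moore_diff_in_cycles:
  assumes x: "x \<in> carrier (moore S (Suc n))"
  shows "moore_diff R S (Suc n) x \<in> carrier (moore_cycles R S n)"
proof (cases n)
  case 0
  with x show ?thesis
    by (simp add: carrier_moore_cycles_0 carrier_moore_Suc moore_diff_closed)
next
  case (Suc m)
  interpret L: nonunital_algebra R "level S m" by (rule level)
  have xl: "x \<in> carrier (level S (Suc (Suc m)))"
    and x0: "\<And>j. j \<le> Suc m \<Longrightarrow> face S (Suc (Suc m)) j x = \<zero>\<^bsub>level S (Suc m)\<^esub>"
    using x by (auto simp: carrier_moore_Suc Suc)
  \<comment> \<open>The indices j \<le> m place the boundary in the normalization, and j = m + 1
    makes it a cycle.\<close>
  have "face S (Suc m) j (moore_diff R S (Suc (Suc m)) x) = \<zero>\<^bsub>level S m\<^esub>" if "j \<le> Suc m" for j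
    using that xl by (subst moore_diff_Suc) (simp add: faceD face_face x0 face_zero)
  then show ?thesis
    using moore_diff_closed[OF xl]
    by (simp add: Suc carrier_moore_cycles_Suc carrier_moore_Suc moore_diff_Suc[of m])
qed

lemma nonunital_algebra_moore_cycles: "nonunital_algebra R (moore_cycles R S n)"
proof (cases n)
  case 0
  then show ?thesis
    by (subst moore_cycles_eq) (simp add: carrier_moore_cycles_0 level)
next
  case (Suc m)
  interpret L: nonunital_algebra R "level S (Suc m)" by (rule level)
  interpret K: nonunital_algebra R "level S m" by (rule level)
  \<comment> \<open>The sign is kept with the left factor, so the product is a cycle as soon as the
    differential of \<open>x\<close> vanishes.\<close>
  have mult: "moore_diff R S (Suc m) (x \<otimes>\<^bsub>level S (Suc m)\<^esub> y) =
      moore_diff R S (Suc m) x \<otimes>\<^bsub>level S m\<^esub> face S (Suc m) (Suc m) y"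
    if "x \<in> carrier (level S (Suc m))" "y \<in> carrier (level S (Suc m))" for x y
    using that by (simp add: moore_diff_Suc faceD K.smult_mult_l)
  have mem: "x \<in> carrier (moore_cycles R S (Suc m)) \<longleftrightarrow> x \<in> carrier (level S (Suc m)) \<and>
      (\<forall>j\<le>m. face S (Suc m) j x = \<zero>\<^bsub>level S m\<^esub>) \<and> moore_diff R S (Suc m) x = \<zero>\<^bsub>level S m\<^esub>" for x
    by (simp add: carrier_moore_cycles_Suc carrier_moore_Suc conj_assoc)
  show ?thesis
    unfolding Suc
    by (subst moore_cycles_eq, rule L.nonunital_algebra_subalgebra)
      (simp_all add: subset_iff mem faceD face_zero moore_diff_zero moore_diff_add
        moore_diff_smult mult K.zero_mult L.mult_closed)
qed

lemma moore_smult_closed: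
  assumes "a \<in> carrier R" "x \<in> carrier (moore S (Suc n))"
  shows "a \<odot>\<^bsub>level S (Suc n)\<^esub> x \<in> carrier (moore S (Suc n))"
proof -
  interpret L: nonunital_algebra R "level S (Suc n)" by (rule level)
  interpret K: nonunital_algebra R "level S n" by (rule level)
  show ?thesis
    using assms by (auto simp: carrier_moore_Suc faceD)
qed

lemma moore_boundaries_algebra_ideal:
  "algebra_ideal R (moore_cycles R S n) (moore_boundaries R S n)"
proof -
  interpret L: nonunital_algebra R "level S (Suc n)" by (rule level)
  interpret K: nonunital_algebra R "level S n" by (rule level)
  interpret Z: nonunital_algebra R "moore_cycles R S n" by (rule nonunital_algebra_moore_cycles)
  let ?I = "moore_boundaries R S n" and ?Z = "moore_cycles R S n"
  have ops: "x \<oplus>\<^bsub>?Z\<^esub> y = x \<oplus>\<^bsub>level S n\<^esub> y" "x \<otimes>\<^bsub>?Z\<^esub> y = x \<otimes>\<^bsub>level S n\<^esub> y"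
    "\<zero>\<^bsub>?Z\<^esub> = \<zero>\<^bsub>level S n\<^esub>" "a \<odot>\<^bsub>?Z\<^esub> x = a \<odot>\<^bsub>level S n\<^esub> x" for x y a
    by (simp_all add: moore_cycles_def moore_def)
  have sub: "?I \<subseteq> carrier ?Z"
    by (auto simp: moore_boundaries_def moore_diff_in_cycles)
  have cyc: "y \<in> carrier (level S n)" if "y \<in> carrier ?Z" for y
    using that by (simp add: moore_cycles_def moore_def)
  have lev: "x \<in> carrier (level S (Suc n))" if "x \<in> carrier (moore S (Suc n))" for x
    using that by (simp add: carrier_moore_Suc)
  \<comment> \<open>Shown before the subgroup property because negatives are obtained as multiples
    by -1.\<close>
  have smult: "a \<odot>\<^bsub>?Z\<^esub> u \<in> ?I" if "a \<in> carrier R" "u \<in> ?I" for a u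
    using that moore_smult_closed
    by (force simp: moore_boundaries_def ops lev moore_diff_smult[symmetric])
  have "subgroup ?I (add_monoid ?Z)"
  proof (rule Z.add.subgroupI)
    show "?I \<subseteq> carrier ?Z"
      by (rule sub)
    show "?I \<noteq> {}"
      using moore_diff_zero[of n] by (auto simp: moore_boundaries_def carrier_moore_Suc face_zero intro!: exI[of _ "\<zero>\<^bsub>level S (Suc n)\<^esub>"])
    show "\<ominus>\<^bsub>?Z\<^esub> u \<in> ?I" if "u \<in> ?I" for u
      using smult[of "\<ominus> \<one>" u] that sub Z.smult_l_minus[of \<one> u] by auto
    show "u \<oplus>\<^bsub>?Z\<^esub> v \<in> ?I" if uv: "u \<in> ?I" "v \<in> ?I" for u v
    proof -
      obtain x y where x: "x \<in> carrier (moore S (Suc n))" "u = moore_diff R S (Suc n) x"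
        and y: "y \<in> carrier (moore S (Suc n))" "v = moore_diff R S (Suc n) y"
        using uv by (auto simp: moore_boundaries_def)
      then have "x \<oplus>\<^bsub>level S (Suc n)\<^esub> y \<in> carrier (moore S (Suc n))"
        by (simp add: carrier_moore_Suc faceD)
      then show ?thesis
        using x y by (auto simp: moore_boundaries_def ops lev simp flip: moore_diff_add)
    qed
  qed
  moreover have "u \<otimes>\<^bsub>?Z\<^esub> y \<in> ?I" if u: "u \<in> ?I" and y: "y \<in> carrier ?Z" for u y
  proof -
    obtain x where x: "x \<in> carrier (moore S (Suc n))" "u = moore_diff R S (Suc n) x"
      using u by (auto simp: moore_boundaries_def)
    \<comment> \<open>Faces are multiplicative, so those that annihilate x annihilate every product
      with x; the product remains in the normalization although the degeneracy of y need not lie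
      there.\<close>
    then have "x \<otimes>\<^bsub>level S (Suc n)\<^esub> degen S n n y \<in> carrier (moore S (Suc n))"
      using cyc[OF y] by (auto simp: carrier_moore_Suc faceD degenD L.mult_closed K.zero_mult)
    then show ?thesis
      using x cyc[OF y] by (auto simp: moore_boundaries_def ops lev simp flip: moore_diff_degen_mult)
  qed
  moreover have "y \<otimes>\<^bsub>?Z\<^esub> u \<in> ?I" if u: "u \<in> ?I" and y: "y \<in> carrier ?Z" for u y
  proof -
    obtain x where x: "x \<in> carrier (moore S (Suc n))" "u = moore_diff R S (Suc n) x"
      using u by (auto simp: moore_boundaries_def)
    then have "degen S n n y \<otimes>\<^bsub>level S (Suc n)\<^esub> x \<in> carrier (moore S (Suc n))"
      using cyc[OF y] by (auto simp: carrier_moore_Suc faceD degenD L.mult_closed K.mult_zero)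
    then show ?thesis
      using x cyc[OF y] by (auto simp: moore_boundaries_def ops lev simp flip: moore_diff_degen_mult)
  qed
  ultimately show ?thesis
    using smult by (intro algebra_ideal.intro algebra_ideal_axioms.intro additive_subgroup.intro)
      (auto simp: nonunital_algebra_moore_cycles)
qed

end

text \<open>Normalization, cycles and boundaries are cut out by faces and scalars alone. A levelwise
  isomorphism commuting with the faces therefore restricts to cycles and matches the boundary
  ideals.\<close>

lemma isomorphic_moore_homology:
  assumes S: "moore_algebra R S" and T: "moore_algebra R T"
    and hom: "\<And>n. h n \<in> algebra_hom R (level S n) (level T n)"
    and bij: "\<And>n. bij_betw (h n) (carrier (level S n)) (carrier (level T n))"
    and nat: "\<And>n j x. \<lbrakk>j \<le> Suc n; x \<in> carrier (level S (Suc n))\<rbrakk> \<Longrightarrow>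
      h n (face S (Suc n) j x) = face T (Suc n) j (h (Suc n) x)"
  shows "isomorphic_algebras R (moore_homology R S n) (moore_homology R T n)"
proof -
  interpret S: moore_algebra R S by fact
  interpret T: moore_algebra R T by fact
  note homD = algebra_homD[OF hom]
  \<comment> \<open>Reflection of zero, not only its preservation, is what makes the image of a
    kernel the whole corresponding kernel in \<open>T\<close>.\<close>
  have zero: "h n x = \<zero>\<^bsub>level T n\<^esub> \<longleftrightarrow> x = \<zero>\<^bsub>level S n\<^esub>" if "x \<in> carrier (level S n)" for n x
  proof -
    interpret L: nonunital_algebra R "level S n" by (rule S.level)
    have "h n \<zero>\<^bsub>level S n\<^esub> = \<zero>\<^bsub>level T n\<^esub>"
      by (rule L.algebra_hom_zero[OF hom T.level])
    then show ?thesis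
      using bij[of n] that by (metis L.M.zero_closed bij_betw_imp_inj_on inj_on_eq_iff)
  qed
  have diff: "h n (moore_diff R S (Suc n) x) = moore_diff R T (Suc n) (h (Suc n) x)"
    if "x \<in> carrier (level S (Suc n))" for n x
    using that by (simp add: S.moore_diff_Suc T.moore_diff_Suc homD S.faceD nat)
  have onto: "h n ` {x \<in> carrier (level S n). P x} = {y \<in> carrier (level T n). Q y}"
    if "\<And>x. x \<in> carrier (level S n) \<Longrightarrow> P x \<longleftrightarrow> Q (h n x)" for n P Q
    unfolding bij_betw_imp_surj_on[OF bij, of n, symmetric] using that by auto
  have face0: "face S (Suc n) j x = \<zero>\<^bsub>level S n\<^esub> \<longleftrightarrow> face T (Suc n) j (h (Suc n) x) = \<zero>\<^bsub>level T n\<^esub>"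
    if "j \<le> Suc n" "x \<in> carrier (level S (Suc n))" for n j x
    using that zero[of "face S (Suc n) j x" n] by (simp add: S.faceD nat)
  have moore: "h (Suc n) ` carrier (moore S (Suc n)) = carrier (moore T (Suc n))" for n
    unfolding S.carrier_moore_Suc T.carrier_moore_Suc by (rule onto) (simp add: face0)
  have diff0: "moore_diff R S (Suc n) x = \<zero>\<^bsub>level S n\<^esub> \<longleftrightarrow>
      moore_diff R T (Suc n) (h (Suc n) x) = \<zero>\<^bsub>level T n\<^esub>"
    if "x \<in> carrier (level S (Suc n))" for n x
    using that zero[of "moore_diff R S (Suc n) x" n] by (simp add: S.moore_diff_closed diff)
  have cycles: "h n ` carrier (moore_cycles R S n) = carrier (moore_cycles R T n)"
  proof (cases n)
    case 0
    then show ?thesis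
      using bij[of 0] by (simp add: S.carrier_moore_cycles_0 T.carrier_moore_cycles_0 bij_betw_def)
  next
    case (Suc m)
    have "h (Suc m) ` {x \<in> carrier (level S (Suc m)).
        (\<forall>j\<le>m. face S (Suc m) j x = \<zero>\<^bsub>level S m\<^esub>) \<and> moore_diff R S (Suc m) x = \<zero>\<^bsub>level S m\<^esub>} =
      {x \<in> carrier (level T (Suc m)).
        (\<forall>j\<le>m. face T (Suc m) j x = \<zero>\<^bsub>level T m\<^esub>) \<and> moore_diff R T (Suc m) x = \<zero>\<^bsub>level T m\<^esub>}"
      by (rule onto) (simp add: face0 diff0)
    then show ?thesis
      by (simp add: Suc S.carrier_moore_cycles_Suc T.carrier_moore_cycles_Suc
          S.carrier_moore_Suc T.carrier_moore_Suc conj_assoc)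
  qed
  have sub: "carrier (moore_cycles R S n) \<subseteq> carrier (level S n)"
    by (auto simp: moore_cycles_def moore_def)
  have "h n ` moore_boundaries R S n = (\<lambda>x. moore_diff R T (Suc n) (h (Suc n) x)) ` carrier (moore S (Suc n))"
    by (force simp: moore_boundaries_def S.carrier_moore_Suc diff image_iff)
  also have "\<dots> = moore_boundaries R T n"
    by (simp add: moore_boundaries_def image_image flip: moore)
  finally have bd: "h n ` moore_boundaries R S n = moore_boundaries R T n" .
  have "h n \<in> algebra_hom R (moore_cycles R S n) (moore_cycles R T n)"
    using cycles sub by (auto simp: algebra_hom_def homD subset_iff moore_cycles_def moore_def)
  moreover have "bij_betw (h n) (carrier (moore_cycles R S n)) (carrier (moore_cycles R T n))"
    using bij_betw_subset[OF bij sub cycles] .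
  ultimately show ?thesis
    unfolding moore_homology_def
    using bd S.moore_boundaries_algebra_ideal T.moore_boundaries_algebra_ideal
    by (intro isomorphic_quotient_algebras)
qed

section \<open>Maps between simplices\<close>

abbreviation simplex_space :: "nat \<Rightarrow> (nat \<Rightarrow> real) topology" where
  "simplex_space n \<equiv> subtopology (powertop_real UNIV) (standard_simplex n)"

lemma continuous_map_simplical_face:
  assumes "j \<le> Suc n"
  shows "continuous_map (simplex_space n) (simplex_space (Suc n)) (simplical_face j)"
proof -
  have "continuous_map (powertop_real UNIV) euclideanreal (\<lambda>x. if i < j then x i else if i = j then 0 else x (i - 1))" for i
    by (auto intro: continuous_map_product_projection)
  then have "continuous_map (simplex_space n) (powertop_real UNIV) (simplical_face j)"
    by (simp add: simplical_face_def continuous_map_componentwise_UNIV continuous_map_from_subtopology)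
  moreover have "simplical_face j \<in> standard_simplex n \<rightarrow> standard_simplex (Suc n)"
    using assms simplical_face_in_standard_simplex[of "Suc n" j] by auto
  ultimately show ?thesis
    by (simp add: continuous_map_in_subtopology)
qed

text \<open>Induction starts at n = k, where the merged entry x_k + x_{k+1} stands for two terms.
  Beyond it, entries are merely shifted by one.\<close>

lemma sum_simplical_degen:
  assumes "k \<le> n"
  shows "(\<Sum>j\<le>n. simplical_degen k x j) = (\<Sum>j\<le>Suc n. x j)"
  using assms
proof (induction n rule: dec_induct)
  case base
  have "(\<Sum>j\<le>k. simplical_degen k x j) = (\<Sum>j<k. simplical_degen k x j) + simplical_degen k x k"
    by (simp flip: lessThan_Suc_atMost)
  also have "(\<Sum>j<k. simplical_degen k x j) = (\<Sum>j<k. x j)"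
    by (simp add: simplical_degen_def)
  finally show ?case
    by (simp add: simplical_degen_def flip: lessThan_Suc_atMost)
next
  case (step n)
  then show ?case
    by (simp add: simplical_degen_def)
qed

lemma simplical_degen_in_standard_simplex:
  assumes "k \<le> n" and x: "x \<in> standard_simplex (Suc n)"
  shows "simplical_degen k x \<in> standard_simplex n"
proof -
  let ?y = "simplical_degen k x"
  have nonneg: "0 \<le> ?y j" for j
    using x by (simp add: standard_simplex_def simplical_degen_def)
  have zero: "?y j = 0" if "j > n" for j
    using x that assms(1) by (auto simp: standard_simplex_def simplical_degen_def)
  have sum: "sum ?y {..n} = 1"
    using x by (simp add: sum_simplical_degen[OF assms(1)] standard_simplex_def)
  \<comment> \<open>The upper bound on coordinates is part of \<open>standard_simplex\<close>; it
    follows because one nonnegative entry is at most the total sum 1.\<close>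
  have "?y j \<le> 1" for j
  proof (cases "j \<le> n")
    case True
    with nonneg have "?y j \<le> sum ?y {..n}"
      by (intro member_le_sum) auto
    with sum show ?thesis by simp
  qed (simp add: zero)
  with nonneg zero sum show ?thesis
    by (simp add: standard_simplex_def)
qed

lemma continuous_map_simplical_degen:
  assumes "k \<le> n"
  shows "continuous_map (simplex_space (Suc n)) (simplex_space n) (simplical_degen k)"
proof -
  have "continuous_map (powertop_real UNIV) euclideanreal
      (\<lambda>x. if i < k then x i else if i = k then x k + x (Suc k) else x (Suc i))" for i
    by (auto intro!: continuous_map_add continuous_map_product_projection)
  then have "continuous_map (simplex_space (Suc n)) (powertop_real UNIV) (simplical_degen k)"
    by (simp add: simplical_degen_def continuous_map_componentwise_UNIV continuous_map_from_subtopology)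
  with assms show ?thesis
    by (auto simp: continuous_map_in_subtopology simplical_degen_in_standard_simplex)
qed

text \<open>Cosimplicial identity on arbitrary sequences. Precomposition reverses the order of
  composition, which turns it into \<open>face_face\<close> for traces.\<close>

lemma simplical_face_simplical_face:
  "j \<le> Suc n \<Longrightarrow> simplical_face (Suc (Suc n)) (simplical_face j t) =
    simplical_face j (simplical_face (Suc n) t)"
  by (auto simp: simplical_face_def fun_eq_iff)

lemma simplical_degen_simplical_face: "simplical_degen n (simplical_face (Suc n) t) = t"
  by (auto simp: simplical_face_def simplical_degen_def fun_eq_iff)

section \<open>Paths and traces\<close>

text \<open>The value 0 is attained at some u \<ge> 0, so monotonicity pushes \<phi> 0 down to 0,
  and dually at 1. Reparametrizations thus fix end points.\<close>

lemma nondec_map_surj_endpoints: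
  assumes "nondec_map \<phi>" "\<phi> ` {0..1} = {0..1}"
  shows "\<phi> 0 = 0" "\<phi> 1 = 1"
proof -
  have mono: "\<phi> x \<le> \<phi> y" if "x \<in> {0..1}" "y \<in> {0..1}" "x \<le> y" for x y
    using assms(1) that by (auto simp: nondec_map_def mono_on_def)
  obtain u v where u: "u \<in> {0..1}" "\<phi> u = 0" and v: "v \<in> {0..1}" "\<phi> v = 1"
    using assms(2) by (metis (no_types, lifting) atLeastAtMost_iff imageE order_refl zero_le_one)
  have "\<phi> 0 \<in> {0..1}" "\<phi> 1 \<in> {0..1}"
    using assms(2) by auto
  with mono[of 0 u] mono[of v 1] u v show "\<phi> 0 = 0" "\<phi> 1 = 1"
    by auto
qed

lemma nondec_map_id: "nondec_map (\<lambda>s. s)"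
  by (auto simp: nondec_map_def mono_on_def)

lemma d_map_id: "directed_space X \<Longrightarrow> d_map X X id"
  by (auto simp: d_map_def directed_space_def extensional_restrict)

text \<open>\<open>k\<close> indexes the resulting path. The index of the argument \<open>p\<close>
  enters only through the simplex into which \<theta> maps.\<close>

definition ipath_map :: "nat \<Rightarrow> ('a \<Rightarrow> 'b) \<Rightarrow> ((nat \<Rightarrow> real) \<Rightarrow> nat \<Rightarrow> real) \<Rightarrow> 'a ipath \<Rightarrow> 'b ipath" where
  "ipath_map k f \<theta> p = restrict (\<lambda>(s, t). f (p (s, \<theta> t))) (ipath_dom k)"

text \<open>Saturation of all results under \<open>trace_rel\<close> is copied from
  \<open>trace_face\<close> and \<open>trace_degen\<close>, so these become literal
  instances.\<close>

definition trace_map ::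
  "'b dspace \<Rightarrow> nat \<Rightarrow> ('a \<Rightarrow> 'b) \<Rightarrow> ((nat \<Rightarrow> real) \<Rightarrow> nat \<Rightarrow> real) \<Rightarrow> 'a ipath set \<Rightarrow> 'b ipath set" where
  "trace_map Y k f \<theta> T = trace_rel Y k `` (ipath_map k f \<theta> ` T)"

definition trace_class :: "'a dspace \<Rightarrow> nat \<Rightarrow> 'a ipath \<Rightarrow> 'a ipath set" where
  "trace_class X i p = trace_rel X i `` {p}"

lemma ipathsD:
  assumes "p \<in> ipaths X i"
  shows "p \<in> extensional (ipath_dom i)"
    and "continuous_map (prod_topology (subtopology euclideanreal {0..1}) (simplex_space (i - 1))) (dtop X) p"
    and "t \<in> standard_simplex (i - 1) \<Longrightarrow> restrict (\<lambda>s. p (s, t)) {0..1} \<in> dpaths X"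
  using assms by (auto simp: ipaths_def)

text \<open>Treating f, \<theta> and \<phi> together covers the action \<open>ipath_map\<close>
  (\<phi> the identity) and reparametrization (f and \<theta> identities) with one continuity
  argument.\<close>

lemma ipaths_closed:
  assumes X: "directed_space X" and f: "d_map X Y f"
    and \<theta>: "continuous_map (simplex_space (k - 1)) (simplex_space (i - 1)) \<theta>"
    and \<phi>: "nondec_map \<phi>" and p: "p \<in> ipaths X i"
  shows "restrict (\<lambda>(s, t). f (p (\<phi> s, \<theta> t))) (ipath_dom k) \<in> ipaths Y k"
proof -
  let ?I = "subtopology euclideanreal {0..1}" and ?q = "restrict (\<lambda>(s, t). f (p (\<phi> s, \<theta> t))) (ipath_dom k)"
  have \<phi>': "continuous_map ?I ?I \<phi>"
    using \<phi> by (auto simp: nondec_map_def continuous_map_in_subtopology)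
  have \<theta>': "\<theta> t \<in> standard_simplex (i - 1)" if "t \<in> standard_simplex (k - 1)" for t
    using continuous_map_image_subset_topspace[OF \<theta>] that by auto
  have "continuous_map (prod_topology ?I (simplex_space (k - 1))) (prod_topology ?I (simplex_space (i - 1)))
      (\<lambda>(s, t). (\<phi> s, \<theta> t))"
    using \<phi>' \<theta> by (simp add: continuous_map_prod_top)
  moreover have "continuous_map (dtop X) (dtop Y) f"
    using f by (simp add: d_map_def)
  ultimately have "continuous_map (prod_topology ?I (simplex_space (k - 1))) (dtop Y) (f \<circ> p \<circ> (\<lambda>(s, t). (\<phi> s, \<theta> t)))"
    by (intro continuous_map_compose[OF _ continuous_map_compose[OF ipathsD(2)[OF p]]])
  then have "continuous_map (prod_topology ?I (simplex_space (k - 1))) (dtop Y) ?q"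
    by (rule continuous_map_eq) auto
  moreover have "restrict (\<lambda>s. ?q (s, t)) {0..1} \<in> dpaths Y" if t: "t \<in> standard_simplex (k - 1)" for t
  proof -
    \<comment> \<open>The closure conditions on d-paths concern functions cut off to [0,1], hence
      the nested restrictions. The inner ones disappear because \<phi> maps [0,1] into
      itself.\<close>
    let ?r = "restrict (\<lambda>s. p (s, \<theta> t)) {0..1}"
    have "?r \<in> dpaths X"
      using ipathsD(3)[OF p \<theta>'[OF t]] .
    then have "restrict (?r \<circ> \<phi>) {0..1} \<in> dpaths X"
      using X \<phi> by (simp add: directed_space_def)
    then have "restrict (f \<circ> restrict (?r \<circ> \<phi>) {0..1}) {0..1} \<in> dpaths Y"
      using f by (simp add: d_map_def)
    also have "restrict (f \<circ> restrict (?r \<circ> \<phi>) {0..1}) {0..1} = restrict (\<lambda>s. ?q (s, t)) {0..1}"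
      using t \<phi> by (intro restrict_ext) (auto simp: nondec_map_def image_subset_iff)
    finally show ?thesis .
  qed
  ultimately show ?thesis
    by (simp add: ipaths_def)
qed

lemma ipath_map_closed:
  assumes "directed_space X" "d_map X Y f"
    and "continuous_map (simplex_space (k - 1)) (simplex_space (i - 1)) \<theta>" and "p \<in> ipaths X i"
  shows "ipath_map k f \<theta> p \<in> ipaths Y k"
  using ipaths_closed[OF assms(1-3) nondec_map_id assms(4)] by (simp add: ipath_map_def)

lemma ipath_map_between:
  assumes "directed_space X" "d_map X Y f"
    and \<theta>: "continuous_map (simplex_space (k - 1)) (simplex_space (i - 1)) \<theta>"
    and p: "p \<in> ipaths_between X i a b"
  shows "ipath_map k f \<theta> p \<in> ipaths_between Y k (f a) (f b)"
proof -
  have "\<theta> t \<in> standard_simplex (i - 1)" if "t \<in> standard_simplex (k - 1)" for t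
    using continuous_map_image_subset_topspace[OF \<theta>] that by auto
  then show ?thesis
    using p ipath_map_closed[OF assms(1-3)] by (simp add: ipaths_between_def ipath_map_def)
qed

lemma reparam_step_closed:
  assumes X: "directed_space X" and "reparam_step X i p q"
  shows "p \<in> ipaths X i" "q \<in> ipaths X i"
proof -
  show p: "p \<in> ipaths X i"
    using assms by (simp add: reparam_step_def)
  obtain \<phi> where "nondec_map \<phi>" "q = restrict (\<lambda>(s, t). p (\<phi> s, t)) (ipath_dom i)"
    using assms by (auto simp: reparam_step_def)
  then show "q \<in> ipaths X i"
    using ipaths_closed[OF X d_map_id[OF X], of i i "\<lambda>t. t"] p by simp
qed

lemma reparam_step_between:
  assumes X: "directed_space X" and pq: "reparam_step X i p q"
  shows "p \<in> ipaths_between X i a b \<longleftrightarrow> q \<in> ipaths_between X i a b"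
proof -
  obtain \<phi> where "nondec_map \<phi>" "\<phi> ` {0..1} = {0..1}" "q = restrict (\<lambda>(s, t). p (\<phi> s, t)) (ipath_dom i)"
    using pq by (auto simp: reparam_step_def)
  with nondec_map_surj_endpoints[OF this(1,2)] reparam_step_closed[OF assms] show ?thesis
    by (simp add: ipaths_between_def)
qed

section \<open>Traces as equivalence classes\<close>

lemma trace_rel_refl: "(p, p) \<in> trace_rel X i"
  by (simp add: trace_rel_def)

text \<open>\<open>equivclp\<close> is reflexive everywhere, so the relation is an equivalence on
  the whole type and classes can be compared without first checking that representatives are
  paths.\<close>

lemma equiv_trace_rel: "equiv UNIV (trace_rel X i)"
  by (auto simp: equiv_def refl_on_def sym_def trans_def trace_rel_def intro: equivclp_sym equivclp_trans)

lemma trace_class_eq_iff: "trace_class X i p = trace_class X i q \<longleftrightarrow> (p, q) \<in> trace_rel X i"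
  unfolding trace_class_def by (rule eq_equiv_class_iff[OF equiv_trace_rel]) simp_all

text \<open>\<open>trace_rel\<close> is the least equivalence containing the steps. In this form the
  rule suits any \<open>P\<close> that is an equality of values or a biimplication.\<close>

lemma trace_rel_induct [consumes 1, case_names refl step sym trans]:
  assumes "(p, q) \<in> trace_rel X i"
    and "\<And>p. P p p" and step: "\<And>p q. reparam_step X i p q \<Longrightarrow> P p q"
    and sym: "\<And>p q. P p q \<Longrightarrow> P q p" and trans: "\<And>p q r. \<lbrakk>P p q; P q r\<rbrakk> \<Longrightarrow> P p r"
  shows "P p q"
proof -
  have "equivclp (reparam_step X i) p q"
    using assms(1) by (simp add: trace_rel_def)
  then show ?thesis
  proof (induction rule: equivclp_induct)
    case base
    show ?case by fact
  next
    case (step y z)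
    then show ?case
      using assms(3-) by blast
  qed
qed

lemma trace_rel_between:
  assumes X: "directed_space X" and pq: "(p, q) \<in> trace_rel X i"
  shows "p \<in> ipaths_between X i a b \<longleftrightarrow> q \<in> ipaths_between X i a b"
  using pq by (induction rule: trace_rel_induct) (auto simp: reparam_step_between[OF X])

lemma reparam_step_in_trace_rel: "reparam_step X i p q \<Longrightarrow> (p, q) \<in> trace_rel X i"
  by (simp add: trace_rel_def r_into_equivclp)

text \<open>\<phi> acts on the first coordinate, \<theta> on the second and f on values; these
  commute, so the same \<phi> is the witness.\<close>

lemma ipath_map_reparam:
  assumes X: "directed_space X" and f: "d_map X Y f"
    and \<theta>: "continuous_map (simplex_space (k - 1)) (simplex_space (i - 1)) \<theta>"
    and pq: "reparam_step X i p q"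
  shows "reparam_step Y k (ipath_map k f \<theta> p) (ipath_map k f \<theta> q)"
proof -
  have \<theta>': "\<theta> t \<in> standard_simplex (i - 1)" if "t \<in> standard_simplex (k - 1)" for t
    using continuous_map_image_subset_topspace[OF \<theta>] that by auto
  obtain \<phi> where \<phi>: "nondec_map \<phi>" "\<phi> ` {0..1} = {0..1}" and q: "q = restrict (\<lambda>(s, t). p (\<phi> s, t)) (ipath_dom i)"
    using pq by (auto simp: reparam_step_def)
  have "\<phi> s \<in> {0..1}" if "s \<in> {0..1}" for s
    using \<phi>(2) that by blast
  then have "ipath_map k f \<theta> q = restrict (\<lambda>(s, t). ipath_map k f \<theta> p (\<phi> s, t)) (ipath_dom k)"
    unfolding q ipath_map_def using \<theta>' by (intro restrict_ext) auto
  with \<phi> ipath_map_closed[OF X f \<theta> reparam_step_closed(1)[OF X pq]] show ?thesis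
    unfolding reparam_step_def by blast
qed

lemma ipath_map_trace_rel:
  assumes "directed_space X" "d_map X Y f"
    and "continuous_map (simplex_space (k - 1)) (simplex_space (i - 1)) \<theta>"
    and pq: "(p, q) \<in> trace_rel X i"
  shows "(ipath_map k f \<theta> p, ipath_map k f \<theta> q) \<in> trace_rel Y k"
  using pq
proof (induction rule: trace_rel_induct)
  case (step p q)
  then show ?case
    by (intro reparam_step_in_trace_rel ipath_map_reparam[OF assms(1-3)])
\<comment> \<open>Reflexivity, symmetry and transitivity are read off from equality of
  classes.\<close>
qed (simp_all flip: trace_class_eq_iff)

lemma trace_class_eqI: "(p, q) \<in> trace_rel X i \<Longrightarrow> trace_class X i p = trace_class X i q"
  by (simp add: trace_class_eq_iff)

lemma in_trace_class_iff: "q \<in> trace_class X i p \<longleftrightarrow> (p, q) \<in> trace_rel X i"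
  by (simp add: trace_class_def)

text \<open>Operations on traces saturate the results of all representatives. This reduces such a
  union to the class of one result, provided all results are equivalent.\<close>

lemma Image_trace_rel_eq_class:
  assumes "p \<in> A" "\<And>q. q \<in> A \<Longrightarrow> (p, q) \<in> trace_rel X i"
  shows "trace_rel X i `` A = trace_class X i p"
proof -
  have "trace_rel X i `` A = (\<Union>q\<in>A. trace_class X i q)"
    by (auto simp: trace_class_def)
  also have "\<dots> = (\<Union>q\<in>A. trace_class X i p)"
    by (intro SUP_cong refl trace_class_eqI[symmetric] assms(2))
  finally show ?thesis
    using assms(1) by auto
qed

lemma trace_map_class:
  assumes "directed_space X" "d_map X Y f"
    and "continuous_map (simplex_space (k - 1)) (simplex_space (i - 1)) \<theta>"
  shows "trace_map Y k f \<theta> (trace_class X i p) = trace_class Y k (ipath_map k f \<theta> p)"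
  unfolding trace_map_def
  by (rule Image_trace_rel_eq_class) (auto simp: in_trace_class_iff trace_rel_refl ipath_map_trace_rel[OF assms])

section \<open>End points of paths and traces\<close>

lemma ipaths_between_endpoints:
  assumes "p \<in> ipaths_between X i a b"
  shows "a \<in> topspace (dtop X)" "b \<in> topspace (dtop X)"
proof -
  obtain t where t: "t \<in> standard_simplex (i - 1)"
    using nonempty_standard_simplex by blast
  have "p (0, t) \<in> topspace (dtop X)" "p (1, t) \<in> topspace (dtop X)"
    using continuous_map_image_subset_topspace[OF ipathsD(2)[of p X i]] assms t
    by (auto simp: ipaths_between_def image_subset_iff)
  with assms t show "a \<in> topspace (dtop X)" "b \<in> topspace (dtop X)"
    by (auto simp: ipaths_between_def)
qed

text \<open>The simplex is nonempty, so evaluating at one of its points recovers the end points.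
  Composability then becomes a single equality of points.\<close>

lemma ipaths_between_unique:
  assumes "p \<in> ipaths_between X i a b" "p \<in> ipaths_between X i a' b'"
  shows "a = a'" "b = b'"
proof -
  obtain t where t: "t \<in> standard_simplex (i - 1)"
    using nonempty_standard_simplex by blast
  with assms show "a = a'" "b = b'"
    by (auto simp: ipaths_between_def)
qed

lemma traces_between_eq: "traces_between X i a b = trace_class X i ` ipaths_between X i a b"
  by (auto simp: traces_between_def quotient_def trace_class_def)

lemma trace_class_in_traces: "p \<in> ipaths_between X i a b \<Longrightarrow> trace_class X i p \<in> traces X i"
  using ipaths_between_endpoints[of p X i a b] by (auto simp: traces_def traces_between_eq)

lemma tracesE:
  assumes "T \<in> traces X i"
  obtains p a b where "p \<in> ipaths_between X i a b" "T = trace_class X i p"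
  using assms by (auto simp: traces_def traces_between_eq)

lemma trace_class_between_iff:
  assumes "directed_space X"
  shows "trace_class X i p \<in> traces_between X i a b \<longleftrightarrow> p \<in> ipaths_between X i a b"
  using trace_rel_between[OF assms] by (auto simp: traces_between_eq trace_class_eq_iff)

section \<open>Concatenation\<close>

lemma ipath_concat_closed:
  assumes X: "directed_space X" and p: "p \<in> ipaths_between X i a b" and q: "q \<in> ipaths_between X i b c"
  shows "ipath_concat i p q \<in> ipaths_between X i a c"
proof -
  let ?I = "subtopology euclideanreal {0..1}"
  let ?P = "prod_topology ?I (simplex_space (i - 1))"
  have pi: "p \<in> ipaths X i" and qi: "q \<in> ipaths X i"
    using p q by (auto simp: ipaths_between_def)
  have fst: "continuous_map ?P euclideanreal fst"
    using continuous_map_fst continuous_map_in_subtopology by blast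
  have snd: "continuous_map ?P (simplex_space (i - 1)) snd"
    by (rule continuous_map_snd)
  \<comment> \<open>The offset \<open>c\<close> is 0 on the first half and 1 on the second. The form
    \<open>2 * fst x - 0\<close> is kept below so that both halves are instances.\<close>
  have half: "continuous_map (subtopology ?P A) ?P (\<lambda>x. (2 * fst x - c, snd x))"
    if "\<And>x. \<lbrakk>x \<in> topspace ?P; x \<in> A\<rbrakk> \<Longrightarrow> 2 * fst x - c \<in> {0..1}" for A c
  proof (rule continuous_map_pairedI)
    show "continuous_map (subtopology ?P A) ?I (\<lambda>x. 2 * fst x - c)"
      unfolding continuous_map_in_subtopology
    proof
      show "continuous_map (subtopology ?P A) euclideanreal (\<lambda>x. 2 * fst x - c)"
        by (intro continuous_map_from_subtopology continuous_map_diff continuous_map_real_mult fst) auto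
    qed (use that in auto)
  qed (intro continuous_map_from_subtopology snd)
  have "continuous_map ?P (dtop X)
      (\<lambda>x. if fst x \<le> 1/2 then (p \<circ> (\<lambda>x. (2 * fst x - 0, snd x))) x else (q \<circ> (\<lambda>x. (2 * fst x - 1, snd x))) x)"
  proof (rule continuous_map_cases_le)
    show "continuous_map (subtopology ?P {x \<in> topspace ?P. fst x \<le> 1/2}) (dtop X) (p \<circ> (\<lambda>x. (2 * fst x - 0, snd x)))"
      by (rule continuous_map_compose[OF half ipathsD(2)[OF pi]]) auto
    show "continuous_map (subtopology ?P {x \<in> topspace ?P. 1/2 \<le> fst x}) (dtop X) (q \<circ> (\<lambda>x. (2 * fst x - 1, snd x)))"
      by (rule continuous_map_compose[OF half ipathsD(2)[OF qi]]) auto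
    \<comment> \<open>Gluing at s = 1/2: the end of \<open>p\<close> meets the start of
      \<open>q\<close>, and both are \<open>b\<close>.\<close>
    show "(p \<circ> (\<lambda>x. (2 * fst x - 0, snd x))) x = (q \<circ> (\<lambda>x. (2 * fst x - 1, snd x))) x"
      if "x \<in> topspace ?P" "fst x = 1/2" for x
    proof -
      have "2 * fst x = 1" "snd x \<in> standard_simplex (i - 1)"
        using that by auto
      then show ?thesis
        using p q by (simp add: ipaths_between_def)
    qed
  qed (simp_all add: fst[simplified])
  then have "continuous_map ?P (dtop X) (ipath_concat i p q)"
    by (rule continuous_map_eq) (auto simp: ipath_concat_def)
  moreover have "restrict (\<lambda>s. ipath_concat i p q (s, t)) {0..1} \<in> dpaths X"
    if t: "t \<in> standard_simplex (i - 1)" for t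
  proof -
    let ?p = "restrict (\<lambda>s. p (s, t)) {0..1}" and ?q = "restrict (\<lambda>s. q (s, t)) {0..1}"
    have "?p 1 = ?q 0"
      using p q t by (simp add: ipaths_between_def)
    then have "path_concat ?p ?q \<in> dpaths X"
      using X ipathsD(3)[OF pi t] ipathsD(3)[OF qi t] unfolding directed_space_def by blast
    also have "path_concat ?p ?q = restrict (\<lambda>s. ipath_concat i p q (s, t)) {0..1}"
      unfolding path_concat_def by (intro restrict_ext) (use t in \<open>auto simp: ipath_concat_def\<close>)
    finally show ?thesis .
  qed
  ultimately have "ipath_concat i p q \<in> ipaths X i"
    by (simp add: ipaths_def ipath_concat_def)
  with p q show ?thesis
    by (auto simp: ipaths_between_def ipath_concat_def)
qed

lemma reparam_step_ipath_concat:
  assumes X: "directed_space X" and p: "p \<in> ipaths_between X i a b" and q: "q \<in> ipaths_between X i b c"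
    and \<phi>: "nondec_map \<phi>" "\<phi> ` {0..1} = {0..1}" and \<psi>: "nondec_map \<psi>" "\<psi> ` {0..1} = {0..1}"
  shows "reparam_step X i (ipath_concat i p q)
    (ipath_concat i (restrict (\<lambda>(s, t). p (\<phi> s, t)) (ipath_dom i)) (restrict (\<lambda>(s, t). q (\<psi> s, t)) (ipath_dom i)))"
proof -
  \<comment> \<open>\<omega> is \<phi> scaled to [0,1/2] followed by \<psi> scaled to [1/2,1], so
    one reparametrization of the concatenation performs both.\<close>
  define \<omega> where "\<omega> = (\<lambda>s. if s \<le> 1/2 then \<phi> (2 * s) / 2 else (1 + \<psi> (2 * s - 1)) / 2)"
  note e = nondec_map_surj_endpoints[OF \<phi>] nondec_map_surj_endpoints[OF \<psi>]
  have r: "\<phi> s \<in> {0..1}" "\<psi> s \<in> {0..1}" if "s \<in> {0..1}" for s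
    using \<phi>(2) \<psi>(2) that by blast+
  have mono: "\<phi> s \<le> \<phi> s'" "\<psi> s \<le> \<psi> s'" if "s \<in> {0..1}" "s' \<in> {0..1}" "s \<le> s'" for s s'
    using \<phi>(1) \<psi>(1) that by (auto simp: nondec_map_def mono_on_def)
  have "continuous_on {0..1} \<omega>"
  proof -
    have cont: "continuous_on {0..1} \<phi>" "continuous_on {0..1} \<psi>"
      using \<phi>(1) \<psi>(1) by (auto simp: nondec_map_def)
    have overlap: "\<phi> (2 * s) = 1 + \<psi> (2 * s - 1)" if "s * 2 = 1" for s
    proof -
      from that have "2 * s = 1" by simp
      then show ?thesis by (simp add: e)
    qed
    have "continuous_on ({0..1/2} \<union> {1/2..1}) (\<lambda>s. if s \<le> 1/2 then \<phi> (2 * s) / 2 else (1 + \<psi> (2 * s - 1)) / 2)"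
    proof (rule continuous_on_cases)
      show "continuous_on {0..1/2} (\<lambda>s. \<phi> (2 * s) / 2)"
        by (intro continuous_intros continuous_on_compose2[OF cont(1)]) auto
      show "continuous_on {1/2..1} (\<lambda>s. (1 + \<psi> (2 * s - 1)) / 2)"
        by (intro continuous_intros continuous_on_compose2[OF cont(2)]) auto
    qed (auto simp: overlap)
    moreover have "{0..1/2} \<union> {1/2..1} = {0..1::real}"
      by auto
    ultimately show ?thesis
      by (simp add: \<omega>_def)
  qed
  moreover have "\<omega> s \<in> {0..1}" if "s \<in> {0..1}" for s
    using that r[of "2 * s"] r[of "2 * s - 1"] by (auto simp: \<omega>_def)
  moreover have "mono_on {0..1} \<omega>"
  proof (rule mono_onI)
    fix s s' :: real assume s: "s \<in> {0..1}" "s' \<in> {0..1}" "s \<le> s'"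
    then show "\<omega> s \<le> \<omega> s'"
      using mono(1)[of "2 * s" "2 * s'"] mono(2)[of "2 * s - 1" "2 * s' - 1"] r(1)[of "2 * s"] r(2)[of "2 * s' - 1"]
      by (auto simp: \<omega>_def)
  qed
  ultimately have "nondec_map \<omega>"
    by (auto simp: nondec_map_def)
  moreover have "\<omega> ` {0..1} = {0..1}"
  proof
    show "\<omega> ` {0..1} \<subseteq> {0..1}"
      using \<open>nondec_map \<omega>\<close> by (simp add: nondec_map_def)
    have "\<omega> 0 = 0" "\<omega> 1 = 1"
      by (simp_all add: \<omega>_def e)
    then show "{0..1} \<subseteq> \<omega> ` {0..1}"
      using IVT'[of \<omega> 0 _ 1] \<open>nondec_map \<omega>\<close> by (force simp: nondec_map_def)
  qed
  moreover have "ipath_concat i (restrict (\<lambda>(s, t). p (\<phi> s, t)) (ipath_dom i)) (restrict (\<lambda>(s, t). q (\<psi> s, t)) (ipath_dom i))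
      = restrict (\<lambda>(s, t). ipath_concat i p q (\<omega> s, t)) (ipath_dom i)"
  proof -
    have "(if s \<le> 1/2 then p (\<phi> (2 * s), t) else q (\<psi> (2 * s - 1), t)) = ipath_concat i p q (\<omega> s, t)"
      if st: "s \<in> {0..1}" "t \<in> standard_simplex (i - Suc 0)" for s t
    proof (cases "s \<le> 1/2")
      case True
      then show ?thesis
        using st r(1)[of "2 * s"] by (simp add: ipath_concat_def \<omega>_def)
    next
      case False
      then have w: "\<psi> (2 * s - 1) = 2 * \<omega> s - 1" and r': "0 \<le> 2 * \<omega> s - 1" "\<omega> s \<le> 1"
        using st r(2)[of "2 * s - 1"] by (auto simp: \<omega>_def field_simps)
      show ?thesis
      proof (cases "\<omega> s \<le> 1/2")
        \<comment> \<open>Here s > 1/2 although \<omega> s \<le> 1/2, which forces \<omega> s = 1/2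
          as \<psi> is nonnegative. One side evaluates the end of \<open>p\<close>, the other the
          start of \<open>q\<close>, and both are \<open>b\<close>.\<close>
        case True
        with r' have "2 * \<omega> s = 1"
          by simp
        with False st w True show ?thesis
          using p q by (simp add: ipath_concat_def ipaths_between_def)
      qed (use False st w r' in \<open>simp add: ipath_concat_def\<close>)
    qed
    note eq = this
    show ?thesis
      unfolding ipath_concat_def[of i "restrict _ _"] by (intro restrict_ext) (auto simp: eq[symmetric])
  qed
  ultimately show ?thesis
    using ipath_concat_closed[OF X p q] unfolding reparam_step_def ipaths_between_def by blast
qed

lemma ipaths_restrict: "p \<in> ipaths_between X i a b \<Longrightarrow> restrict p (ipath_dom i) = p"
  by (simp add: ipaths_between_def ipaths_def extensional_restrict)

text \<open>\<open>F\<close> is controlled only on paths with the given end points, whereas the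
  induction passes through arbitrary ones. Pairing invariance of this membership with the
  conditional equality of classes gives an equivalence, as \<open>trace_rel_induct\<close>
  requires.\<close>

lemma trace_rel_lift:
  assumes X: "directed_space X" and pq: "(p, q) \<in> trace_rel X i" and p: "p \<in> ipaths_between X i a b"
    and step: "\<And>p q. \<lbrakk>reparam_step X i p q; p \<in> ipaths_between X i a b\<rbrakk> \<Longrightarrow> (F p, F q) \<in> trace_rel Y k"
  shows "(F p, F q) \<in> trace_rel Y k"
proof -
  have "(p \<in> ipaths_between X i a b \<longleftrightarrow> q \<in> ipaths_between X i a b) \<and>
      (p \<in> ipaths_between X i a b \<longrightarrow> trace_class Y k (F p) = trace_class Y k (F q))"
    using pq
  proof (induction rule: trace_rel_induct)
    case (step p q)
    then show ?case
      using reparam_step_between[OF X step] assms(4) by (simp add: trace_class_eqI)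
  qed auto
  with p show ?thesis
    by (simp add: trace_class_eq_iff)
qed

text \<open>The factors are changed one at a time, the other being reparametrized by the identity.
  The intermediate path \<open>p'\<close> keeps the end points, so the second change is still
  between composable paths.\<close>

lemma trace_rel_ipath_concat:
  assumes X: "directed_space X"
    and p: "p \<in> ipaths_between X i a b" and q: "q \<in> ipaths_between X i b c"
    and pp': "(p, p') \<in> trace_rel X i" and qq': "(q, q') \<in> trace_rel X i"
  shows "(ipath_concat i p q, ipath_concat i p' q') \<in> trace_rel X i"
proof -
  have id: "(\<lambda>s. s) ` {0..1} = {0..1::real}"
    by simp
  have "(ipath_concat i p q, ipath_concat i p' q) \<in> trace_rel X i"
  proof (rule trace_rel_lift[OF X pp' p])
    fix p p' assume pp': "reparam_step X i p p'" and p: "p \<in> ipaths_between X i a b"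
    then obtain \<phi> where \<phi>: "nondec_map \<phi>" "\<phi> ` {0..1} = {0..1}" "p' = restrict (\<lambda>(s, t). p (\<phi> s, t)) (ipath_dom i)"
      by (auto simp: reparam_step_def)
    show "(ipath_concat i p q, ipath_concat i p' q) \<in> trace_rel X i"
      using reparam_step_ipath_concat[OF X p q \<phi>(1,2) nondec_map_id id]
      by (simp add: \<phi>(3) ipaths_restrict[OF q, simplified] reparam_step_in_trace_rel)
  qed
  moreover have p': "p' \<in> ipaths_between X i a b"
    using trace_rel_between[OF X pp'] p by blast
  have "(ipath_concat i p' q, ipath_concat i p' q') \<in> trace_rel X i"
  proof (rule trace_rel_lift[OF X qq' q])
    fix q q' assume qq': "reparam_step X i q q'" and q: "q \<in> ipaths_between X i b c"
    then obtain \<phi> where \<phi>: "nondec_map \<phi>" "\<phi> ` {0..1} = {0..1}" "q' = restrict (\<lambda>(s, t). q (\<phi> s, t)) (ipath_dom i)"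
      by (auto simp: reparam_step_def)
    show "(ipath_concat i p' q, ipath_concat i p' q') \<in> trace_rel X i"
      using reparam_step_ipath_concat[OF X p' q nondec_map_id id \<phi>(1,2)]
      by (simp add: \<phi>(3) ipaths_restrict[OF p', simplified] reparam_step_in_trace_rel)
  qed
  ultimately show ?thesis
    by (simp flip: trace_class_eq_iff)
qed

lemma trace_concat_class:
  assumes X: "directed_space X" and p: "p \<in> ipaths_between X i a b" and q: "q \<in> ipaths_between X i b c"
  shows "trace_concat X i (trace_class X i p) (trace_class X i q) = trace_class X i (ipath_concat i p q)"
  unfolding trace_concat_def
  by (rule Image_trace_rel_eq_class)
    (auto simp: in_trace_class_iff trace_rel_ipath_concat[OF X p q] intro: trace_rel_refl)

lemma trace_mult_class:
  assumes X: "directed_space X" and p: "p \<in> ipaths_between X i a b" and q: "q \<in> ipaths_between X i b' c"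
  shows "trace_mult X i (trace_class X i p) (trace_class X i q) =
    (if b = b' then Some (trace_class X i (ipath_concat i p q)) else None)"
proof -
  have "(\<exists>a b c. p \<in> ipaths_between X i a b \<and> q \<in> ipaths_between X i b c) \<longleftrightarrow> b = b'"
    using p q ipaths_between_unique by metis
  with p q show ?thesis
    by (auto simp: trace_mult_def trace_class_between_iff[OF X] trace_concat_class[OF X])
qed

lemma reparam_step_ipath_concat_assoc:
  assumes X: "directed_space X" and p: "p \<in> ipaths_between X i a b" and q: "q \<in> ipaths_between X i b c"
    and r: "r \<in> ipaths_between X i c d"
  shows "reparam_step X i (ipath_concat i p (ipath_concat i q r)) (ipath_concat i (ipath_concat i p q) r)"
proof -
  \<comment> \<open>\<phi> carries the breakpoints 1/4 and 1/2 of (p * q) * r to the breakpoints 1/2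
    and 3/4 of p * (q * r). Its slopes 2, 1, 1/2 decrease, so it is concave and equals the minimum
    of its three linear pieces.\<close>
  define \<phi> :: "real \<Rightarrow> real" where "\<phi> = (\<lambda>s. min (2 * s) (min (s + 1/4) (s/2 + 1/2)))"
  have "nondec_map \<phi>"
    unfolding nondec_map_def \<phi>_def by (auto intro!: continuous_intros mono_onI)
  moreover have "\<phi> ` {0..1} = {0..1}"
  proof
    show "\<phi> ` {0..1} \<subseteq> {0..1}"
      using \<open>nondec_map \<phi>\<close> by (simp add: nondec_map_def)
    have "\<phi> 0 = 0" "\<phi> 1 = 1"
      by (simp_all add: \<phi>_def)
    then show "{0..1} \<subseteq> \<phi> ` {0..1}"
      using IVT'[of \<phi> 0 _ 1] \<open>nondec_map \<phi>\<close> by (force simp: nondec_map_def)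
  qed
  moreover have "ipath_concat i (ipath_concat i p q) r =
      restrict (\<lambda>(s, t). ipath_concat i p (ipath_concat i q r) (\<phi> s, t)) (ipath_dom i)"
  proof -
    have "ipath_concat i (ipath_concat i p q) r (s, t) = ipath_concat i p (ipath_concat i q r) (\<phi> s, t)"
      if st: "s \<in> {0..1}" "t \<in> standard_simplex (i - 1)" for s t
    proof -
      consider "s \<le> 1/4" | "1/4 < s" "s \<le> 1/2" | "1/2 < s"
        by linarith
      then show ?thesis
      proof cases
        case 1
        then have "\<phi> s = 2 * s"
          using st by (auto simp: \<phi>_def min_def)
        with 1 st show ?thesis
          by (simp add: ipath_concat_def)
      next
        case 2
        then have "\<phi> s = s + 1/4"
          using st by (auto simp: \<phi>_def min_def)
        with 2 st show ?thesis
          by (simp add: ipath_concat_def algebra_simps)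
      next
        case 3
        then have "\<phi> s = s/2 + 1/2"
          using st by (auto simp: \<phi>_def min_def)
        with 3 st show ?thesis
          by (simp add: ipath_concat_def algebra_simps)
      qed
    qed
    then show ?thesis
      by (auto simp: ipath_concat_def[of i "ipath_concat i p q"] fun_eq_iff restrict_def)
  qed
  moreover have "ipath_concat i p (ipath_concat i q r) \<in> ipaths X i"
    using ipath_concat_closed[OF X p ipath_concat_closed[OF X q r]] by (simp add: ipaths_between_def)
  ultimately show ?thesis
    unfolding reparam_step_def by blast
qed

lemma ipath_map_concat:
  assumes \<theta>: "continuous_map (simplex_space (k - 1)) (simplex_space (i - 1)) \<theta>"
  shows "ipath_map k f \<theta> (ipath_concat i p q) = ipath_concat k (ipath_map k f \<theta> p) (ipath_map k f \<theta> q)"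
proof -
  have "\<theta> t \<in> standard_simplex (i - 1)" if "t \<in> standard_simplex (k - 1)" for t
    using continuous_map_image_subset_topspace[OF \<theta>] that by auto
  then show ?thesis
    unfolding ipath_map_def ipath_concat_def by (intro restrict_ext) auto
qed

section \<open>The simplicial algebra of traces\<close>

lemma d_map_compose:
  assumes f: "d_map X Y f" and g: "d_map Y Z g"
  shows "d_map X Z (g \<circ> f)"
proof -
  have "restrict (g \<circ> f \<circ> p) {0..1} = restrict (g \<circ> restrict (f \<circ> p) {0..1}) {0..1}" for p :: "real \<Rightarrow> _"
    by (intro restrict_ext) simp
  with f g show ?thesis
    by (auto simp: d_map_def intro: continuous_map_compose)
qed

text \<open>Both bracketings are defined under the same condition, b = b' and c = c', and then
  differ by one reparametrization.\<close>

lemma partial_semigroup_traces: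
  assumes X: "directed_space X"
  shows "partial_semigroup (traces X i) (trace_mult X i)"
proof
  fix T U V assume T: "T \<in> traces X i" and U: "U \<in> traces X i"
  obtain p a b where p: "p \<in> ipaths_between X i a b" "T = trace_class X i p"
    using T by (rule tracesE)
  obtain q b' c where q: "q \<in> ipaths_between X i b' c" "U = trace_class X i q"
    using U by (rule tracesE)
  note pq = trace_mult_class[OF X p(1) q(1)]
  show "V \<in> traces X i" if "trace_mult X i T U = Some V"
    using that ipath_concat_closed[OF X p(1)] q(1)
    by (auto simp: p(2) q(2) pq intro: trace_class_in_traces split: if_splits)
  assume V: "V \<in> traces X i"
  obtain r c' d where r: "r \<in> ipaths_between X i c' d" "V = trace_class X i r"
    using V by (rule tracesE)
  note qr = trace_mult_class[OF X q(1) r(1)]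
  have "Option.bind (trace_mult X i T U) (\<lambda>W. trace_mult X i W V) =
      (if b = b' \<and> c = c' then Some (trace_class X i (ipath_concat i (ipath_concat i p q) r)) else None)"
    using trace_mult_class[OF X ipath_concat_closed[OF X p(1)] r(1)] q(1)
    by (auto simp: p(2) q(2) r(2) pq)
  also have "\<dots> = (if b = b' \<and> c = c' then Some (trace_class X i (ipath_concat i p (ipath_concat i q r))) else None)"
  proof (cases "b = b' \<and> c = c'")
    case True
    then have "reparam_step X i (ipath_concat i p (ipath_concat i q r)) (ipath_concat i (ipath_concat i p q) r)"
      using p(1) q(1) r(1) by (intro reparam_step_ipath_concat_assoc[OF X]) auto
    from trace_class_eqI[OF reparam_step_in_trace_rel[OF this]] show ?thesis
      by simp
  qed auto
  also have "\<dots> = Option.bind (trace_mult X i U V) (trace_mult X i T)"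
    using trace_mult_class[OF X p(1) ipath_concat_closed[OF X q(1)]] r(1)
    by (auto simp: p(2) q(2) r(2) qr)
  finally show "Option.bind (trace_mult X i T U) (\<lambda>W. trace_mult X i W V) =
      Option.bind (trace_mult X i U V) (trace_mult X i T)" .
qed

lemma trace_map_in_traces:
  assumes X: "directed_space X" and f: "d_map X Y f"
    and \<theta>: "continuous_map (simplex_space (k - 1)) (simplex_space (i - 1)) \<theta>"
    and T: "T \<in> traces X i"
  shows "trace_map Y k f \<theta> T \<in> traces Y k"
proof -
  obtain p a b where p: "p \<in> ipaths_between X i a b" "T = trace_class X i p"
    using T by (rule tracesE)
  then show ?thesis
    using trace_class_in_traces[OF ipath_map_between[OF X f \<theta>]] by (simp add: trace_map_class[OF X f \<theta>])
qed

text \<open>Injectivity of \<open>f\<close> keeps non-composable traces non-composable.\<close>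

lemma trace_map_partial_semigroup_hom:
  assumes X: "directed_space X" and Y: "directed_space Y" and f: "d_map X Y f"
    and inj: "inj_on f (topspace (dtop X))"
    and \<theta>: "continuous_map (simplex_space (k - 1)) (simplex_space (i - 1)) \<theta>"
  shows "trace_map Y k f \<theta> \<in>
    partial_semigroup_hom (traces X i) (trace_mult X i) (traces Y k) (trace_mult Y k)"
proof -
  have "trace_mult Y k (trace_map Y k f \<theta> T) (trace_map Y k f \<theta> U) =
      map_option (trace_map Y k f \<theta>) (trace_mult X i T U)"
    if T: "T \<in> traces X i" and U: "U \<in> traces X i" for T U
  proof -
    obtain p a b where p: "p \<in> ipaths_between X i a b" "T = trace_class X i p"
      using T by (rule tracesE)
    obtain q b' c where q: "q \<in> ipaths_between X i b' c" "U = trace_class X i q"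
      using U by (rule tracesE)
    have "f b = f b' \<longleftrightarrow> b = b'"
      using inj ipaths_between_endpoints[OF p(1)] ipaths_between_endpoints[OF q(1)]
      by (simp add: inj_on_eq_iff)
    then show ?thesis
      using trace_mult_class[OF Y ipath_map_between[OF X f \<theta> p(1)] ipath_map_between[OF X f \<theta> q(1)]]
      by (simp add: p(2) q(2) trace_map_class[OF X f \<theta>] trace_mult_class[OF X p(1) q(1)]
          ipath_map_concat[OF \<theta>])
  qed
  then show ?thesis
    by (auto simp: partial_semigroup_hom_def trace_map_in_traces[OF X f \<theta>])
qed

text \<open>The action is covariant in the map of spaces and contravariant in the map of simplices,
  hence the two opposite orders of composition.\<close>

lemma trace_map_trace_map:
  assumes X: "directed_space X" and Y: "directed_space Y" and f: "d_map X Y f" and g: "d_map Y Z g"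
    and \<theta>: "continuous_map (simplex_space (k - 1)) (simplex_space (i - 1)) \<theta>"
    and \<eta>: "continuous_map (simplex_space (l - 1)) (simplex_space (k - 1)) \<eta>"
    and T: "T \<in> traces X i"
  shows "trace_map Z l g \<eta> (trace_map Y k f \<theta> T) = trace_map Z l (g \<circ> f) (\<theta> \<circ> \<eta>) T"
proof -
  obtain p a b where p: "p \<in> ipaths_between X i a b" "T = trace_class X i p"
    using T by (rule tracesE)
  have "\<eta> t \<in> standard_simplex (k - 1)" if "t \<in> standard_simplex (l - 1)" for t
    using continuous_map_image_subset_topspace[OF \<eta>] that by auto
  then have "ipath_map l g \<eta> (ipath_map k f \<theta> p) = ipath_map l (g \<circ> f) (\<theta> \<circ> \<eta>) p"
    unfolding ipath_map_def by (intro restrict_ext) auto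
  then show ?thesis
    by (simp add: p(2) trace_map_class[OF X f \<theta>] trace_map_class[OF Y g \<eta>]
        trace_map_class[OF X d_map_compose[OF f g] continuous_map_compose[OF \<eta> \<theta>]])
qed

text \<open>\<open>f\<close> is required to fix only points of the space. This covers a composite of
  a dihomeomorphism with its inverse, which is known to be the identity only there.\<close>

lemma trace_map_ident:
  assumes X: "directed_space X" and f: "d_map X X f"
    and fx: "\<And>x. x \<in> topspace (dtop X) \<Longrightarrow> f x = x"
    and T: "T \<in> traces X i"
  shows "trace_map X i f (\<lambda>t. t) T = T"
proof -
  obtain p a b where p: "p \<in> ipaths_between X i a b" "T = trace_class X i p"
    using T by (rule tracesE)
  then have pi: "p \<in> ipaths X i"
    by (simp add: ipaths_between_def)
  have "ipath_map i f (\<lambda>t. t) p = restrict p (ipath_dom i)"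
    unfolding ipath_map_def using continuous_map_image_subset_topspace[OF ipathsD(2)[OF pi]]
    by (intro restrict_ext) (auto simp: image_subset_iff fx)
  then show ?thesis
    using ipathsD(1)[OF pi] by (simp add: p(2) trace_map_class[OF X f] extensional_restrict)
qed

lemma trace_face_eq: "trace_face X i j = trace_map X i id (simplical_face j)"
  by (simp add: fun_eq_iff trace_face_def trace_map_def ipath_face_def[abs_def] ipath_map_def[abs_def])

lemma trace_degen_eq: "trace_degen X i k = trace_map X (Suc i) id (simplical_degen k)"
  by (simp add: fun_eq_iff trace_degen_def trace_map_def ipath_degen_def[abs_def] ipath_map_def[abs_def])

text \<open>Degree n consists of (n+1)-traces: the face out of it yields n-traces and the degeneracy
  (n+2)-traces, which explains the indices \<open>n\<close> and \<open>Suc (Suc n)\<close>.\<close>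

lemma simplicial_trace_algebra_simps:
  "level (simplicial_trace_algebra R X) n = free_algebra R (traces X (Suc n)) (trace_mult X (Suc n))"
  "face (simplicial_trace_algebra R X) n j = linear_extension R (trace_map X n id (simplical_face j))"
  "degen (simplicial_trace_algebra R X) n k =
    linear_extension R (trace_map X (Suc (Suc n)) id (simplical_degen k))"
  by (simp_all add: simplicial_trace_algebra_def trace_algebra_def trace_face_eq trace_degen_eq)

text \<open>The next two lemmas write the dimensions in the form \<open>i - 1\<close> that occurs in \<open>ipath_dom i\<close>.\<close>

lemma continuous_map_ipath_face:
  "j \<le> Suc n \<Longrightarrow> continuous_map (simplex_space (Suc n - 1)) (simplex_space (Suc (Suc n) - 1)) (simplical_face j)"
  using continuous_map_simplical_face by simp

lemma continuous_map_ipath_degen: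
  "k \<le> n \<Longrightarrow> continuous_map (simplex_space (Suc (Suc n) - 1)) (simplex_space (Suc n - 1)) (simplical_degen k)"
  using continuous_map_simplical_degen by simp

text \<open>Faces and degeneracies leave points of the space alone, so injectivity is trivial and
  they are homomorphisms. Each simplicial identity is proved on basis traces and transported by
  linear extension.\<close>

lemma moore_algebra_simplicial_trace_algebra:
  assumes R: "cring R" and X: "directed_space X"
  shows "moore_algebra R (simplicial_trace_algebra R X)"
proof -
  interpret cring R by fact
  note id = d_map_id[OF X]
  note ps = partial_semigroup_traces[OF X]
  note closed = trace_map_in_traces[OF X id]
  have inj: "inj_on id (topspace (dtop X))"
    by simp
  show ?thesis
  proof (intro moore_algebra.intro moore_algebra_axioms.intro R, goal_cases)
    case (1 n)
    show ?case
      unfolding simplicial_trace_algebra_simps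
      by (rule partial_semigroup.nonunital_algebra_free_algebra[OF ps R])
  next
    case (2 j n)
    then show ?case
      unfolding simplicial_trace_algebra_simps
      by (intro linear_extension_algebra_hom[OF R ps ps] trace_map_partial_semigroup_hom[OF X X id inj] continuous_map_ipath_face)
  next
    case (3 n)
    then show ?case
      unfolding simplicial_trace_algebra_simps
      by (intro linear_extension_algebra_hom[OF R ps ps] trace_map_partial_semigroup_hom[OF X X id inj] continuous_map_ipath_degen order_refl)
  next
    case (4 x n)
    note x = 4[unfolded simplicial_trace_algebra_simps]
    have "trace_map X (Suc n) id (simplical_face (Suc n)) (trace_map X (Suc (Suc n)) id (simplical_degen n) T) = T"
      if T: "T \<in> traces X (Suc n)" for T
    proof -
      \<comment> \<open>A degeneracy followed by a face of traces precomposes with these maps in the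
        opposite order.\<close>
      have "simplical_degen n \<circ> simplical_face (Suc n) = (\<lambda>t. t)"
        by (simp add: fun_eq_iff simplical_degen_simplical_face)
      then show ?thesis
        using trace_map_trace_map[OF X X id id continuous_map_ipath_degen[OF order_refl] continuous_map_ipath_face[OF order_refl] T]
          trace_map_ident[OF X id _ T] by simp
    qed
    then have "linear_extension R (trace_map X (Suc n) id (simplical_face (Suc n)) \<circ>
        trace_map X (Suc (Suc n)) id (simplical_degen n)) x = linear_extension R (\<lambda>T. T) x"
      by (intro linear_extension_cong[OF _ x]) simp
    also have "\<dots> = x"
      by (rule linear_extension_id[OF x])
    finally show ?case
      unfolding simplicial_trace_algebra_simps
      by (subst linear_extension_compose[OF funcsetI[OF closed[OF continuous_map_ipath_degen[OF order_refl]]] x])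
  next
    case (5 j n x)
    note x = 5(2)[unfolded simplicial_trace_algebra_simps]
    have "trace_map X (Suc n) id (simplical_face j) (trace_map X (Suc (Suc n)) id (simplical_face (Suc (Suc n))) T) =
        trace_map X (Suc n) id (simplical_face (Suc n)) (trace_map X (Suc (Suc n)) id (simplical_face j) T)"
      if T: "T \<in> traces X (Suc (Suc (Suc n)))" for T
    proof -
      have "simplical_face (Suc (Suc n)) \<circ> simplical_face j =
          simplical_face j \<circ> (simplical_face (Suc n) :: (nat \<Rightarrow> real) \<Rightarrow> _)"
        by (rule ext) (simp add: simplical_face_simplical_face[OF 5(1)])
      then show ?thesis
        using 5(1) by (simp add: trace_map_trace_map[OF X X id id continuous_map_ipath_face continuous_map_ipath_face T])
    qed
    then have "linear_extension R (trace_map X (Suc n) id (simplical_face j) \<circ>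
        trace_map X (Suc (Suc n)) id (simplical_face (Suc (Suc n)))) x =
      linear_extension R (trace_map X (Suc n) id (simplical_face (Suc n)) \<circ>
        trace_map X (Suc (Suc n)) id (simplical_face j)) x"
      by (intro linear_extension_cong[OF _ x]) simp
    moreover have maps: "trace_map X (Suc (Suc n)) id (simplical_face k) \<in> traces X (Suc (Suc (Suc n))) \<rightarrow> traces X (Suc (Suc n))"
      if "k \<le> Suc (Suc n)" for k
      by (intro funcsetI closed[OF continuous_map_ipath_face[OF that]])
    ultimately show ?case
      unfolding simplicial_trace_algebra_simps
      using 5(1) by (simp add: linear_extension_compose[OF maps x])
  qed
qed

section \<open>Invariance\<close>

lemma isomorphic_free_algebras:
  assumes R: "cring R" and B: "partial_semigroup B c" and D: "partial_semigroup D e"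
    and h: "h \<in> partial_semigroup_hom B c D e" and k: "k \<in> D \<rightarrow> B"
    and kh: "\<And>b. b \<in> B \<Longrightarrow> k (h b) = b" and hk: "\<And>d. d \<in> D \<Longrightarrow> h (k d) = d"
  shows "isomorphic_algebras R (free_algebra R B c) (free_algebra R D e)"
proof -
  have "h \<in> B \<rightarrow> D"
    using h by (simp add: partial_semigroup_hom_def)
  then show ?thesis
    unfolding isomorphic_algebras_def
    using bij_betw_linear_extension[OF R _ k kh hk, where c = c and e = e]
      linear_extension_algebra_hom[OF R B D h]
      partial_semigroup.nonunital_algebra_free_algebra[OF B R]
      partial_semigroup.nonunital_algebra_free_algebra[OF D R] by blast
qed

text \<open>The product stays in the basis because reachability is transitive, by concatenation of
  d-paths.\<close>

lemma partial_semigroup_reachable_pairs: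
  assumes X: "directed_space X"
  shows "partial_semigroup (reachable_pairs X) pair_mult"
proof
  fix u v w assume u: "u \<in> reachable_pairs X" and v: "v \<in> reachable_pairs X"
  show "w \<in> reachable_pairs X" if w: "pair_mult u v = Some w"
  proof -
    obtain p where p: "p \<in> dpaths X" "p 0 = fst u" "p 1 = snd u"
      using u by (auto simp: reachable_pairs_def)
    obtain q where q: "q \<in> dpaths X" "q 0 = fst v" "q 1 = snd v"
      using v by (auto simp: reachable_pairs_def)
    from w have uv: "snd u = fst v" "w = (fst u, snd v)"
      by (auto simp: pair_mult_def split: if_splits)
    with p q have "path_concat p q \<in> dpaths X"
      using X unfolding directed_space_def by metis
    moreover have "path_concat p q 0 = fst u" "path_concat p q 1 = snd v"
      using p q by (simp_all add: path_concat_def)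
    ultimately show ?thesis
      unfolding uv(2) reachable_pairs_def by auto
  qed
qed (simp add: pair_mult_def)

lemma map_prod_reachable_pairs:
  assumes f: "d_map X Y f" and u: "u \<in> reachable_pairs X"
  shows "map_prod f f u \<in> reachable_pairs Y"
proof -
  obtain p where p: "p \<in> dpaths X" "p 0 = fst u" "p 1 = snd u"
    using u by (auto simp: reachable_pairs_def)
  with f have fp: "restrict (f \<circ> p) {0..1} \<in> dpaths Y"
    by (simp add: d_map_def)
  have "restrict (f \<circ> p) {0..1} 0 = f (fst u)" "restrict (f \<circ> p) {0..1} 1 = f (snd u)"
    using p by simp_all
  then show ?thesis
    by (auto simp: reachable_pairs_def map_prod_def split_beta intro!: bexI[OF _ fp])
qed

text \<open>Needed because the two maps of a dihomeomorphism are mutually inverse only on the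
  underlying spaces.\<close>

lemma reachable_pairs_topspace:
  assumes X: "directed_space X" and "u \<in> reachable_pairs X"
  shows "fst u \<in> topspace (dtop X)" "snd u \<in> topspace (dtop X)"
proof -
  obtain p where p: "p \<in> dpaths X" "p 0 = fst u" "p 1 = snd u"
    using assms(2) by (auto simp: reachable_pairs_def)
  then have "continuous_map (subtopology euclideanreal {0..1}) (dtop X) p"
    using X by (simp add: directed_space_def pathin_def)
  from continuous_map_image_subset_topspace[OF this]
  have "p 0 \<in> topspace (dtop X)" "p 1 \<in> topspace (dtop X)"
    by (auto simp: image_subset_iff)
  with p show "fst u \<in> topspace (dtop X)" "snd u \<in> topspace (dtop X)"
    by simp_all
qed

theorem proposition1:
  fixes R :: "('r, 'm) ring_scheme"
    and X :: "'a dspace" and Y :: "'b dspace"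
  assumes "cring R"
    and "directed_space X" and "directed_space Y"
    and "dihomeomorphic X Y"
  shows "isomorphic_algebras R (HA_zero R X) (HA_zero R Y) \<and>
         (\<forall>i. isomorphic_algebras R (HA_Suc R X i) (HA_Suc R Y i))"
proof -
  note R = assms(1) and X = assms(2) and Y = assms(3)
  interpret cring R by fact
  obtain f g where f: "d_map X Y f" and g: "d_map Y X g"
    and gf: "\<And>x. x \<in> topspace (dtop X) \<Longrightarrow> g (f x) = x"
    and fg: "\<And>y. y \<in> topspace (dtop Y) \<Longrightarrow> f (g y) = y"
    using assms(4) by (auto simp: dihomeomorphic_def homeomorphic_maps_def)
  have inj: "inj_on f (topspace (dtop X))"
    using gf by (rule inj_on_inverseI)
  have "isomorphic_algebras R (HA_zero R X) (HA_zero R Y)"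
    unfolding HA_zero_def
  proof (rule isomorphic_free_algebras[OF R, where h = "map_prod f f" and k = "map_prod g g"])
    \<comment> \<open>Composability of pairs is an equality of points, so injectivity of
      \<open>f\<close> is again what preserves undefined products.\<close>
    show "map_prod f f \<in> partial_semigroup_hom (reachable_pairs X) pair_mult (reachable_pairs Y) pair_mult"
      using map_prod_reachable_pairs[OF f] reachable_pairs_topspace[OF X] inj
      by (auto simp: partial_semigroup_hom_def pair_mult_def inj_on_eq_iff)
    show "map_prod g g (map_prod f f u) = u" if "u \<in> reachable_pairs X" for u
      using reachable_pairs_topspace[OF X that] by (cases u) (simp add: gf)
    show "map_prod f f (map_prod g g u) = u" if "u \<in> reachable_pairs Y" for u
      using reachable_pairs_topspace[OF Y that] by (cases u) (simp add: fg)
  qed (auto simp: partial_semigroup_reachable_pairs X Y map_prod_reachable_pairs[OF g])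
  moreover have "isomorphic_algebras R (HA_Suc R X i) (HA_Suc R Y i)" for i
    unfolding HA_Suc_def
  proof (rule isomorphic_moore_homology)
    let ?S = "simplicial_trace_algebra R X" and ?T = "simplicial_trace_algebra R Y"
    \<comment> \<open>The index is \<open>Suc n\<close> because degree n holds (n+1)-traces.\<close>
    let ?f = "\<lambda>n. trace_map Y (Suc n) f (\<lambda>t. t)" and ?g = "\<lambda>n. trace_map X (Suc n) g (\<lambda>t. t)"
    have id: "continuous_map (simplex_space n) (simplex_space n) (\<lambda>t. t)" for n
      by simp
    show "moore_algebra R ?S" "moore_algebra R ?T"
      using R X Y by (simp_all add: moore_algebra_simplicial_trace_algebra)
    show "linear_extension R (?f n) \<in> algebra_hom R (level ?S n) (level ?T n)" for n
      unfolding simplicial_trace_algebra_simps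
      by (intro linear_extension_algebra_hom R partial_semigroup_traces X Y
          trace_map_partial_semigroup_hom f inj id)
    have gf_trace: "?g n (?f n T) = T" if T: "T \<in> traces X (Suc n)" for n T
      unfolding trace_map_trace_map[OF X Y f g id id T]
      using trace_map_ident[OF X d_map_compose[OF f g] _ T] by (simp add: gf comp_def)
    have fg_trace: "?f n (?g n T) = T" if T: "T \<in> traces Y (Suc n)" for n T
      unfolding trace_map_trace_map[OF Y X g f id id T]
      using trace_map_ident[OF Y d_map_compose[OF g f] _ T] by (simp add: fg comp_def)
    show "bij_betw (linear_extension R (?f n)) (carrier (level ?S n)) (carrier (level ?T n))" for n
      unfolding simplicial_trace_algebra_simps
      by (intro bij_betw_linear_extension[OF R, of _ _ _ "?g n"] funcsetI trace_map_in_traces[OF X f id]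
          trace_map_in_traces[OF Y g id] gf_trace fg_trace)
    show "linear_extension R (?f n) (face ?S (Suc n) j x) = face ?T (Suc n) j (linear_extension R (?f (Suc n)) x)"
      if j: "j \<le> Suc n" and "x \<in> carrier (level ?S (Suc n))" for n j x
    proof -
      note x = that(2)[unfolded simplicial_trace_algebra_simps]
      note idX = d_map_id[OF X] and idY = d_map_id[OF Y]
      have face: "trace_map X (Suc n) id (simplical_face j) \<in> traces X (Suc (Suc n)) \<rightarrow> traces X (Suc n)"
        by (intro funcsetI trace_map_in_traces[OF X idX continuous_map_ipath_face[OF j]])
      have push: "?f (Suc n) \<in> traces X (Suc (Suc n)) \<rightarrow> traces Y (Suc (Suc n))"
        by (intro funcsetI trace_map_in_traces[OF X f id])
      \<comment> \<open>Both sides equal the action of \<open>f\<close> together with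
        \<open>simplical_face j\<close>: postcomposition and precomposition do not
        interfere.\<close>
      have "?f n (trace_map X (Suc n) id (simplical_face j) T) =
          trace_map Y (Suc n) id (simplical_face j) (?f (Suc n) T)" if T: "T \<in> traces X (Suc (Suc n))" for T
        unfolding trace_map_trace_map[OF X X idX f continuous_map_ipath_face[OF j] id T]
          trace_map_trace_map[OF X Y f idY id continuous_map_ipath_face[OF j] T]
        by (simp add: comp_def)
      then show ?thesis
        unfolding simplicial_trace_algebra_simps linear_extension_compose[OF face x]
          linear_extension_compose[OF push x]
        by (intro linear_extension_cong[OF _ x]) simp
    qed
  qed
  ultimately show ?thesis
    by blast
qed

end
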